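(* Let $R$ be a commutative noetherian local ring and let $M$ be a finitely generated quasi-perfect $R$-module of grade $g$. Then $\operatorname{Supp}(M)=\operatorname{Supp}(\operatorname{Ext}^{g}_R(M,R))$. In particular, $\dim(M)=\dim(\operatorname{Ext}^{g}_R(M,R))$.
   Context: A finitely generated module $M$ is called quasi-perfect if $\inf\{i:\operatorname{Ext}^i_R(M,R)\neq 0\}=\sup\{i:\operatorname{Ext}^i_R(M,R)\neq 0\}$. The grade of $M$ is $\inf\{i:\operatorname{Ext}^i_R(M,R)\neq 0\}$. The dimension of a module is the Krull dimension of its support. *)

theory Defs
  imports
    "HOL-Algebra.Module"
    "HOL-Algebra.AbelCoset"
    "HOL-Algebra.Ring_Divisibility"
    "HOL-Analysis.Abstract_Topology"
    "HOL-Library.Extended_Real"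
begin

text \<open>
  Throughout, the fields \<^const>\<open>mult\<close> and \<^const>\<open>one\<close> that a \<^typ>\<open>('r, 'm) module\<close> record
  inherits from \<^typ>\<open>'m ring\<close> play no role; they are left \<^const>\<open>undefined\<close>.
\<close>

section \<open>Modules and their homomorphisms\<close>

definition local_ring :: "('r, 'e) ring_scheme \<Rightarrow> bool" where
  "local_ring R \<longleftrightarrow> cring R \<and> (\<exists>!\<mm>. maximalideal \<mm> R)"

definition finitely_generated_module :: "('r, 'e) ring_scheme \<Rightarrow> ('r, 'm) module \<Rightarrow> bool" where
  "finitely_generated_module R M \<longleftrightarrow>
     (\<exists>A. finite A \<and> A \<subseteq> carrier M \<and>
       (\<forall>x\<in>carrier M. \<exists>c\<in>A \<rightarrow> carrier R. x = (\<Oplus>\<^bsub>M\<^esub>a\<in>A. c a \<odot>\<^bsub>M\<^esub> a)))"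

definition nonzero_module :: "('r, 'm) module \<Rightarrow> bool" where
  "nonzero_module M \<longleftrightarrow> carrier M \<noteq> {\<zero>\<^bsub>M\<^esub>}"

definition regular_module :: "('r, 'e) ring_scheme \<Rightarrow> ('r, 'r) module" where
  "regular_module R =
     \<lparr>carrier = carrier R, mult = (\<lambda>_ _. undefined), one = undefined,
      zero = \<zero>\<^bsub>R\<^esub>, add = add R, smult = mult R\<rparr>"

text \<open>
  Homomorphisms are extensional functions, so that equality of homomorphisms is HOL equality.
\<close>

definition module_hom ::
  "('r, 'e) ring_scheme \<Rightarrow> ('r, 'm) module \<Rightarrow> ('r, 'n) module \<Rightarrow> ('m \<Rightarrow> 'n) set" where
  "module_hom R M N =
     {f \<in> carrier M \<rightarrow>\<^sub>E carrier N.
        (\<forall>x\<in>carrier M. \<forall>y\<in>carrier M. f (x \<oplus>\<^bsub>M\<^esub> y) = f x \<oplus>\<^bsub>N\<^esub> f y) \<and>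
        (\<forall>a\<in>carrier R. \<forall>x\<in>carrier M. f (a \<odot>\<^bsub>M\<^esub> x) = a \<odot>\<^bsub>N\<^esub> f x)}"

definition Hom_module ::
  "('r, 'e) ring_scheme \<Rightarrow> ('r, 'm) module \<Rightarrow> ('r, 'n) module \<Rightarrow> ('r, 'm \<Rightarrow> 'n) module" where
  "Hom_module R M N =
     \<lparr>carrier = module_hom R M N, mult = (\<lambda>_ _. undefined), one = undefined,
      zero = (\<lambda>x\<in>carrier M. \<zero>\<^bsub>N\<^esub>),
      add = (\<lambda>f g. \<lambda>x\<in>carrier M. f x \<oplus>\<^bsub>N\<^esub> g x),
      smult = (\<lambda>a f. \<lambda>x\<in>carrier M. a \<odot>\<^bsub>N\<^esub> f x)\<rparr>"

definition quotient_module :: "('r, 'm) module \<Rightarrow> 'm set \<Rightarrow> ('r, 'm set) module" where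
  "quotient_module M K =
     \<lparr>carrier = a_rcosets\<^bsub>M\<^esub> K, mult = (\<lambda>_ _. undefined), one = undefined,
      zero = K, add = set_add M,
      smult = (\<lambda>a X. \<Union>x\<in>X. K +>\<^bsub>M\<^esub> (a \<odot>\<^bsub>M\<^esub> x))\<rparr>"

text \<open>The free module on the set \<open>B\<close>: finitely supported functions on \<open>B\<close>, extended by zero.\<close>

definition free_module :: "('r, 'e) ring_scheme \<Rightarrow> 'b set \<Rightarrow> ('r, 'b \<Rightarrow> 'r) module" where
  "free_module R B =
     \<lparr>carrier = {f. range f \<subseteq> carrier R \<and> finite {b. f b \<noteq> \<zero>\<^bsub>R\<^esub>} \<and> {b. f b \<noteq> \<zero>\<^bsub>R\<^esub>} \<subseteq> B},
      mult = (\<lambda>_ _. undefined), one = undefined,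
      zero = (\<lambda>_. \<zero>\<^bsub>R\<^esub>),
      add = (\<lambda>f g b. f b \<oplus>\<^bsub>R\<^esub> g b),
      smult = (\<lambda>a f b. a \<otimes>\<^bsub>R\<^esub> f b)\<rparr>"

section \<open>Ext\<close>

text \<open>
  \<open>\<dots> \<rightarrow> F\<^sub>2 \<rightarrow> F\<^sub>1 \<rightarrow> F\<^sub>0 \<rightarrow> M \<rightarrow> 0\<close> is exact, where \<open>F\<^sub>i\<close> is the free module on \<open>B i\<close>,
  \<open>d i : F\<^sub>i\<^sub>+\<^sub>1 \<rightarrow> F\<^sub>i\<close> and \<open>\<epsilon> : F\<^sub>0 \<rightarrow> M\<close>.
\<close>

definition free_resolution ::
  "('r, 'e) ring_scheme \<Rightarrow> ('r, 'm) module \<Rightarrow>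
   (nat \<Rightarrow> 'b set) \<Rightarrow> (nat \<Rightarrow> ('b \<Rightarrow> 'r) \<Rightarrow> ('b \<Rightarrow> 'r)) \<Rightarrow> (('b \<Rightarrow> 'r) \<Rightarrow> 'm) \<Rightarrow> bool" where
  "free_resolution R M B d \<epsilon> \<longleftrightarrow>
     \<epsilon> \<in> module_hom R (free_module R (B 0)) M \<and>
     (\<forall>i. d i \<in> module_hom R (free_module R (B (Suc i))) (free_module R (B i))) \<and>
     \<epsilon> ` carrier (free_module R (B 0)) = carrier M \<and>
     d 0 ` carrier (free_module R (B 1)) =
       {x \<in> carrier (free_module R (B 0)). \<epsilon> x = \<zero>\<^bsub>M\<^esub>} \<and>
     (\<forall>i. d (Suc i) ` carrier (free_module R (B (Suc (Suc i)))) =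
       {x \<in> carrier (free_module R (B (Suc i))). d i x = \<zero>\<^bsub>free_module R (B i)\<^esub>})"

text \<open>Cocycles, coboundaries and cohomology of the complex \<open>Hom (F\<^sub>\<bullet>, N)\<close>.\<close>

definition Hom_cocycles ::
  "('r, 'e) ring_scheme \<Rightarrow> (nat \<Rightarrow> 'b set) \<Rightarrow> (nat \<Rightarrow> ('b \<Rightarrow> 'r) \<Rightarrow> ('b \<Rightarrow> 'r)) \<Rightarrow>
   ('r, 'n) module \<Rightarrow> nat \<Rightarrow> (('b \<Rightarrow> 'r) \<Rightarrow> 'n) set" where
  "Hom_cocycles R B d N i =
     {f \<in> module_hom R (free_module R (B i)) N.
        compose (carrier (free_module R (B (Suc i)))) f (d i) =
          \<zero>\<^bsub>Hom_module R (free_module R (B (Suc i))) N\<^esub>}"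

definition Hom_coboundaries ::
  "('r, 'e) ring_scheme \<Rightarrow> (nat \<Rightarrow> 'b set) \<Rightarrow> (nat \<Rightarrow> ('b \<Rightarrow> 'r) \<Rightarrow> ('b \<Rightarrow> 'r)) \<Rightarrow>
   ('r, 'n) module \<Rightarrow> nat \<Rightarrow> (('b \<Rightarrow> 'r) \<Rightarrow> 'n) set" where
  "Hom_coboundaries R B d N i =
     (case i of
        0 \<Rightarrow> {\<zero>\<^bsub>Hom_module R (free_module R (B 0)) N\<^esub>}
      | Suc j \<Rightarrow> (\<lambda>f. compose (carrier (free_module R (B i))) f (d j)) `
                   module_hom R (free_module R (B j)) N)"

definition Hom_cohomology ::
  "('r, 'e) ring_scheme \<Rightarrow> (nat \<Rightarrow> 'b set) \<Rightarrow> (nat \<Rightarrow> ('b \<Rightarrow> 'r) \<Rightarrow> ('b \<Rightarrow> 'r)) \<Rightarrow>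
   ('r, 'n) module \<Rightarrow> nat \<Rightarrow> ('r, (('b \<Rightarrow> 'r) \<Rightarrow> 'n) set) module" where
  "Hom_cohomology R B d N i =
     quotient_module
       ((Hom_module R (free_module R (B i)) N)\<lparr>carrier := Hom_cocycles R B d N i\<rparr>)
       (Hom_coboundaries R B d N i)"

text \<open>
  Ext is computed from a chosen free resolution; as usual the result does not depend on the
  choice up to isomorphism.  The bases are taken inside the type \<^typ>\<open>('r + 'm) list\<close>, which is
  infinite and at least as large as \<open>R\<close> and \<open>M\<close>.  Hence a free module on a subset
  of this type is no larger than the type itself, and every module has a free resolution of
  this form.
\<close>

definition some_free_resolution ::
  "('r, 'e) ring_scheme \<Rightarrow> ('r, 'm) module \<Rightarrow>
   (nat \<Rightarrow> ('r + 'm) list set) \<times>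
   (nat \<Rightarrow> (('r + 'm) list \<Rightarrow> 'r) \<Rightarrow> (('r + 'm) list \<Rightarrow> 'r))" where
  "some_free_resolution R M = (SOME (B, d). \<exists>\<epsilon>. free_resolution R M B d \<epsilon>)"

definition Ext ::
  "('r, 'e) ring_scheme \<Rightarrow> nat \<Rightarrow> ('r, 'm) module \<Rightarrow> ('r, 'n) module \<Rightarrow>
   ('r, ((('r + 'm) list \<Rightarrow> 'r) \<Rightarrow> 'n) set) module" where
  "Ext R i M N = (case some_free_resolution R M of (B, d) \<Rightarrow> Hom_cohomology R B d N i)"

section \<open>Grade and quasi-perfect modules\<close>

text \<open>
  In \<^typ>\<open>ereal\<close>, the infimum of the empty set is \<open>\<infinity>\<close> and its supremum is \<open>-\<infinity>\<close>; in particular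
  a module all of whose Ext modules into \<open>R\<close> vanish is not quasi-perfect.
\<close>

definition Ext_degrees :: "('r, 'e) ring_scheme \<Rightarrow> ('r, 'm) module \<Rightarrow> ereal set" where
  "Ext_degrees R M = {ereal (real i) | i. nonzero_module (Ext R i M (regular_module R))}"

definition grade :: "('r, 'e) ring_scheme \<Rightarrow> ('r, 'm) module \<Rightarrow> ereal" where
  "grade R M = Inf (Ext_degrees R M)"

definition quasi_perfect :: "('r, 'e) ring_scheme \<Rightarrow> ('r, 'm) module \<Rightarrow> bool" where
  "quasi_perfect R M \<longleftrightarrow>
     finitely_generated_module R M \<and> Inf (Ext_degrees R M) = Sup (Ext_degrees R M)"

section \<open>Support\<close>

text \<open>The class of \<open>m/s\<close> in the module of fractions.\<close>

definition fraction ::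
  "'r set \<Rightarrow> ('r, 'm) module \<Rightarrow> 'm \<Rightarrow> 'r \<Rightarrow> ('m \<times> 'r) set" where
  "fraction S M m s =
     {(n, t). n \<in> carrier M \<and> t \<in> S \<and> (\<exists>u\<in>S. u \<odot>\<^bsub>M\<^esub> (t \<odot>\<^bsub>M\<^esub> m) = u \<odot>\<^bsub>M\<^esub> (s \<odot>\<^bsub>M\<^esub> n))}"

text \<open>The module of fractions with denominators in \<open>S\<close>, with its scalars restricted to \<open>R\<close>.\<close>

definition localized_module ::
  "('r, 'e) ring_scheme \<Rightarrow> 'r set \<Rightarrow> ('r, 'm) module \<Rightarrow> ('r, ('m \<times> 'r) set) module" where
  "localized_module R S M =
     \<lparr>carrier = {fraction S M m s | m s. m \<in> carrier M \<and> s \<in> S},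
      mult = (\<lambda>_ _. undefined), one = undefined,
      zero = fraction S M \<zero>\<^bsub>M\<^esub> \<one>\<^bsub>R\<^esub>,
      add = (\<lambda>X Y. \<Union>(m, s)\<in>X. \<Union>(n, t)\<in>Y.
               fraction S M (t \<odot>\<^bsub>M\<^esub> m \<oplus>\<^bsub>M\<^esub> s \<odot>\<^bsub>M\<^esub> n) (s \<otimes>\<^bsub>R\<^esub> t)),
      smult = (\<lambda>a X. \<Union>(m, s)\<in>X. fraction S M (a \<odot>\<^bsub>M\<^esub> m) s)\<rparr>"

definition Spec :: "('r, 'e) ring_scheme \<Rightarrow> 'r set set" where
  "Spec R = {\<pp>. primeideal \<pp> R}"

definition Supp :: "('r, 'e) ring_scheme \<Rightarrow> ('r, 'm) module \<Rightarrow> 'r set set" where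
  "Supp R M = {\<pp> \<in> Spec R. nonzero_module (localized_module R (carrier R - \<pp>) M)}"

section \<open>Krull dimension\<close>

definition Zariski_topology :: "('r, 'e) ring_scheme \<Rightarrow> 'r set topology" where
  "Zariski_topology R = topology_generated_by {{\<pp> \<in> Spec R. a \<notin> \<pp>} | a. a \<in> carrier R}"

definition irreducible_closed :: "'a topology \<Rightarrow> 'a set \<Rightarrow> bool" where
  "irreducible_closed X Z \<longleftrightarrow>
     closedin X Z \<and> Z \<noteq> {} \<and>
     (\<forall>A B. closedin X A \<and> closedin X B \<and> Z = A \<union> B \<longrightarrow> Z = A \<or> Z = B)"

text \<open>The dimension of the empty space, hence of the zero module, is \<open>-\<infinity>\<close>.\<close>

definition Krull_dimension :: "'a topology \<Rightarrow> ereal" where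
  "Krull_dimension X =
     Sup {ereal (real n) | n. \<exists>Z :: nat \<Rightarrow> 'a set.
       (\<forall>i\<le>n. irreducible_closed X (Z i)) \<and> (\<forall>i<n. Z i \<subset> Z (Suc i))}"

definition module_dim :: "('r, 'e) ring_scheme \<Rightarrow> ('r, 'm) module \<Rightarrow> ereal" where
  "module_dim R M = Krull_dimension (subtopology (Zariski_topology R) (Supp R M))"

end

theory Submission
  imports Defs
begin

text \<open>
  If \<open>s\<close> annihilates \<open>M\<close>, then multiplication by \<open>s\<close> is null-homotopic on a free resolution
  \<open>F\<^sub>\<bullet>\<close>, so \<open>s\<close> annihilates every \<open>Ext\<^sup>i(M, R)\<close>; hence the support of Ext is contained
  in that of \<open>M\<close>.

  Conversely let \<open>\<pp>\<close> be in the support of \<open>M\<close> and suppose that all \<open>Ext\<^sup>i(M, R)\<close> vanish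
  locally at \<open>\<pp>\<close>, that is, \<open>Hom (F\<^sub>\<bullet>, R / J)\<close> is acyclic at \<open>\<pp>\<close> for \<open>J = 0\<close>.
  Choose \<open>J \<subseteq> \<pp>\<close> maximal with this property. The property passes from \<open>J\<close> to \<open>J + x R\<close> if
  \<open>x\<close> is a nonzerodivisor modulo \<open>J\<close>, so \<open>\<pp>\<close> consists of zero divisors modulo \<open>J\<close>, and
  \<open>R / \<pp>\<close> embeds into \<open>R / J\<close>. As \<open>M\<close> is finitely generated and nonzero at \<open>\<pp>\<close>, there is a
  nonzero homomorphism from \<open>M\<close> to \<open>R / \<pp>\<close>, which contradicts acyclicity in degree 0.
\<close>

section \<open>Modules\<close>

text \<open>Quasi-perfection turns a statement about one degree into one about all degrees: outside
  degree \<open>g\<close> Ext vanishes outright, so a prime \<pp> missing from the support of Ext in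
  degree \<open>g\<close> makes the whole dual complex acyclic locally at \<pp>.

  The obstacle is the resolution behind \<open>Ext\<close>. It is an arbitrary choice, possibly with
  infinite bases, so Hom out of it need not commute with localization. All arguments therefore stay
  over \<open>R\<close> and carry denominators: each cocycle becomes a coboundary after
  multiplication by an element outside \<pp> that may depend on the cocycle.

  Two facts give the embedding of R / \<pp>. The associated primes of R / J are finite in number, so
  prime avoidance yields one \<open>y\<close> outside \<open>J\<close> with \<pp> y inside
  \<open>J\<close>. And maximality of \<open>J\<close> makes every element outside \<pp> a
  nonzerodivisor modulo \<open>J\<close>, so the annihilator of \<open>y\<close> modulo
  \<open>J\<close> is exactly \<pp>. The second fact also removes the denominator left over in
  degree 0.\<close>

lemma module_homI:
  assumes "f \<in> carrier M \<rightarrow>\<^sub>E carrier N"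
    and "\<And>x y. x \<in> carrier M \<Longrightarrow> y \<in> carrier M \<Longrightarrow> f (x \<oplus>\<^bsub>M\<^esub> y) = f x \<oplus>\<^bsub>N\<^esub> f y"
    and "\<And>a x. a \<in> carrier R \<Longrightarrow> x \<in> carrier M \<Longrightarrow> f (a \<odot>\<^bsub>M\<^esub> x) = a \<odot>\<^bsub>N\<^esub> f x"
  shows "f \<in> module_hom R M N"
  using assms by (simp add: module_hom_def)

lemma module_hom_closed: "f \<in> module_hom R M N \<Longrightarrow> x \<in> carrier M \<Longrightarrow> f x \<in> carrier N"
  by (auto simp: module_hom_def)

lemma module_hom_add:
  "f \<in> module_hom R M N \<Longrightarrow> x \<in> carrier M \<Longrightarrow> y \<in> carrier M \<Longrightarrow> f (x \<oplus>\<^bsub>M\<^esub> y) = f x \<oplus>\<^bsub>N\<^esub> f y"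
  by (auto simp: module_hom_def)

lemma module_hom_smult:
  "f \<in> module_hom R M N \<Longrightarrow> a \<in> carrier R \<Longrightarrow> x \<in> carrier M \<Longrightarrow> f (a \<odot>\<^bsub>M\<^esub> x) = a \<odot>\<^bsub>N\<^esub> f x"
  by (auto simp: module_hom_def)

lemma module_hom_zero:
  assumes "module R M" "module R N" "f \<in> module_hom R M N"
  shows "f \<zero>\<^bsub>M\<^esub> = \<zero>\<^bsub>N\<^esub>"
proof -
  interpret M: module R M by fact
  interpret N: module R N by fact
  have "f (\<zero>\<^bsub>R\<^esub> \<odot>\<^bsub>M\<^esub> \<zero>\<^bsub>M\<^esub>) = \<zero>\<^bsub>R\<^esub> \<odot>\<^bsub>N\<^esub> f \<zero>\<^bsub>M\<^esub>"
    by (rule module_hom_smult[OF assms(3)]) auto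
  then show ?thesis
    using module_hom_closed[OF assms(3), of "\<zero>\<^bsub>M\<^esub>"] by simp
qed

lemma module_hom_minus:
  assumes "module R M" "module R N" "f \<in> module_hom R M N" "x \<in> carrier M" "y \<in> carrier M"
  shows "f (x \<ominus>\<^bsub>M\<^esub> y) = f x \<ominus>\<^bsub>N\<^esub> f y"
proof -
  interpret M: module R M by fact
  interpret N: module R N by fact
  have y: "f (\<ominus>\<^bsub>M\<^esub> y) = \<ominus>\<^bsub>N\<^esub> f y"
    using module_hom_smult[OF assms(3), of "\<ominus>\<^bsub>R\<^esub> \<one>\<^bsub>R\<^esub>" y] assms(5)
      module_hom_closed[OF assms(3,5)]
    by (simp add: M.smult_l_minus N.smult_l_minus)
  then show ?thesis
    using assms by (simp add: a_minus_def module_hom_add)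
qed

lemma compose_module_hom:
  assumes "module R M" "f \<in> module_hom R N P" "g \<in> module_hom R M N"
  shows "compose (carrier M) f g \<in> module_hom R M P"
proof -
  interpret M: module R M by fact
  show ?thesis
    by (rule module_homI)
      (use assms in \<open>auto simp: compose_def module_hom_add module_hom_smult module_hom_closed\<close>)
qed

lemma (in cring) regular_module_module: "module R (regular_module R)"
  by (rule moduleI)
    (auto simp: regular_module_def l_distr r_distr m_assoc is_cring
      intro!: abelian_groupI a_assoc a_comm intro: add.l_inv_ex)

lemma regular_module_simps [simp]:
  "carrier (regular_module R) = carrier R"
  "\<zero>\<^bsub>regular_module R\<^esub> = \<zero>\<^bsub>R\<^esub>"
  "x \<oplus>\<^bsub>regular_module R\<^esub> y = x \<oplus>\<^bsub>R\<^esub> y"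
  "x \<odot>\<^bsub>regular_module R\<^esub> y = x \<otimes>\<^bsub>R\<^esub> y"
  by (simp_all add: regular_module_def)

lemma regular_module_minus [simp]: "x \<ominus>\<^bsub>regular_module R\<^esub> y = x \<ominus>\<^bsub>R\<^esub> y"
  by (simp add: a_minus_def a_inv_def m_inv_def regular_module_def)

section \<open>Free modules\<close>

lemma free_module_simps:
  "x \<oplus>\<^bsub>free_module R B\<^esub> y = (\<lambda>b. x b \<oplus>\<^bsub>R\<^esub> y b)"
  "a \<odot>\<^bsub>free_module R B\<^esub> x = (\<lambda>b. a \<otimes>\<^bsub>R\<^esub> x b)"
  "\<zero>\<^bsub>free_module R B\<^esub> = (\<lambda>_. \<zero>\<^bsub>R\<^esub>)"
  by (simp_all add: free_module_def)

lemma free_module_carrier_iff: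
  "x \<in> carrier (free_module R B) \<longleftrightarrow>
     (\<forall>b. x b \<in> carrier R) \<and> finite {b. x b \<noteq> \<zero>\<^bsub>R\<^esub>} \<and> {b. x b \<noteq> \<zero>\<^bsub>R\<^esub>} \<subseteq> B"
  by (auto simp: free_module_def)

lemma (in cring) free_module_module: "module R (free_module R B)"
proof (rule moduleI)
  have closed: "x \<oplus>\<^bsub>free_module R B\<^esub> y \<in> carrier (free_module R B)"
    if "x \<in> carrier (free_module R B)" "y \<in> carrier (free_module R B)" for x y
  proof -
    have "{b. x b \<oplus> y b \<noteq> \<zero>} \<subseteq> {b. x b \<noteq> \<zero>} \<union> {b. y b \<noteq> \<zero>}"
      by auto
    with that show ?thesis
      by (auto simp: free_module_carrier_iff free_module_simps intro: finite_subset)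
  qed
  have smult: "a \<odot>\<^bsub>free_module R B\<^esub> x \<in> carrier (free_module R B)"
    if "a \<in> carrier R" "x \<in> carrier (free_module R B)" for a x
  proof -
    have "{b. a \<otimes> x b \<noteq> \<zero>} \<subseteq> {b. x b \<noteq> \<zero>}"
      using that by auto
    with that show ?thesis
      by (auto simp: free_module_carrier_iff free_module_simps intro: finite_subset)
  qed
  then show "\<And>a x. a \<in> carrier R \<Longrightarrow> x \<in> carrier (free_module R B) \<Longrightarrow>
     a \<odot>\<^bsub>free_module R B\<^esub> x \<in> carrier (free_module R B)" .
  show "abelian_group (free_module R B)"
  proof (rule abelian_groupI)
    fix x assume x: "x \<in> carrier (free_module R B)"
    show "\<exists>y\<in>carrier (free_module R B). y \<oplus>\<^bsub>free_module R B\<^esub> x = \<zero>\<^bsub>free_module R B\<^esub>"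
      by (rule bexI[OF _ smult[OF _ x, of "\<ominus> \<one>"]])
        (use x in \<open>auto simp: free_module_simps free_module_carrier_iff l_minus l_neg\<close>)
  qed (auto simp: closed, auto simp: free_module_simps free_module_carrier_iff a_ac)
qed (auto simp: is_cring free_module_simps free_module_carrier_iff l_distr r_distr m_assoc)

definition unit_vector :: "('r, 'e) ring_scheme \<Rightarrow> 'b \<Rightarrow> 'b \<Rightarrow> 'r" where
  "unit_vector R b = (\<lambda>c. if c = b then \<one>\<^bsub>R\<^esub> else \<zero>\<^bsub>R\<^esub>)"

lemma (in cring) unit_vector_closed:
  "b \<in> B \<Longrightarrow> unit_vector R b \<in> carrier (free_module R B)"
  by (auto simp: free_module_carrier_iff unit_vector_def)

text \<open>Induction on the size of the support, removing one basis coordinate at a time; it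
  replaces expansions into finite sums of basis vectors.\<close>

lemma (in cring) free_module_induct [consumes 1, case_names zero add]:
  assumes "x \<in> carrier (free_module R B)"
    and "P \<zero>\<^bsub>free_module R B\<^esub>"
    and step: "\<And>a b y. a \<in> carrier R \<Longrightarrow> b \<in> B \<Longrightarrow> y \<in> carrier (free_module R B) \<Longrightarrow> P y \<Longrightarrow>
      P (a \<odot>\<^bsub>free_module R B\<^esub> unit_vector R b \<oplus>\<^bsub>free_module R B\<^esub> y)"
  shows "P x"
  using assms(1)
proof (induction "card {b. x b \<noteq> \<zero>}" arbitrary: x)
  case 0
  then have "x = \<zero>\<^bsub>free_module R B\<^esub>"
    by (auto simp: free_module_carrier_iff free_module_simps)
  with assms(2) show ?case by simp
next
  case (Suc n)
  then obtain b where b: "x b \<noteq> \<zero>"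
    by (metis (mono_tags, lifting) card.empty empty_Collect_eq nat.distinct(1))
  let ?y = "x(b := \<zero>)"
  have eq: "{c. ?y c \<noteq> \<zero>} = {c. x c \<noteq> \<zero>} - {b}"
    by auto
  have y: "?y \<in> carrier (free_module R B)"
    using Suc.prems eq by (auto simp: free_module_carrier_iff)
  have "n = card {c. ?y c \<noteq> \<zero>}"
    unfolding eq using Suc(2) Suc.prems b by (simp add: free_module_carrier_iff)
  from Suc(1)[OF this y] have "P ?y" .
  with Suc.prems b y have "P (x b \<odot>\<^bsub>free_module R B\<^esub> unit_vector R b \<oplus>\<^bsub>free_module R B\<^esub> ?y)"
    by (intro step) (auto simp: free_module_carrier_iff)
  also have "x b \<odot>\<^bsub>free_module R B\<^esub> unit_vector R b \<oplus>\<^bsub>free_module R B\<^esub> ?y = x"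
    using Suc.prems by (auto simp: free_module_carrier_iff free_module_simps unit_vector_def)
  finally show ?case .
qed

text \<open>The existence half of the universal property: send \<open>x\<close> to the sum of its
  coordinates times the prescribed values.\<close>

lemma free_module_hom_exists:
  fixes R (structure) and M :: "('r, 'm) module"
  assumes "module R M" and "\<phi> \<in> B \<rightarrow> carrier M"
  shows "\<exists>h\<in>module_hom R (free_module R B) M. \<forall>b\<in>B. h (unit_vector R b) = \<phi> b"
proof -
  interpret module R M by fact
  interpret F: module R "free_module R B" by (rule free_module_module)
  let ?F = "carrier (free_module R B)"
  define h where "h = (\<lambda>x\<in>?F. \<Oplus>\<^bsub>M\<^esub>b\<in>{b. x b \<noteq> \<zero>}. x b \<odot>\<^bsub>M\<^esub> \<phi> b)"
  \<comment> \<open>The summation range may be enlarged from the support to any finite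
    \<open>T\<close> inside \<open>B\<close>. This gives \<open>x\<close>, \<open>y\<close> and
    their sum a common range although their supports differ.\<close>
  have h: "h x = (\<Oplus>\<^bsub>M\<^esub>b\<in>T. x b \<odot>\<^bsub>M\<^esub> \<phi> b)"
    if "x \<in> ?F" "finite T" "{b. x b \<noteq> \<zero>} \<subseteq> T" "T \<subseteq> B" for x T
    unfolding h_def using that assms
    by (auto simp: free_module_carrier_iff Pi_iff intro!: M.add.finprod_mono_neutral_cong_left)
  have "h \<in> module_hom R (free_module R B) M"
  proof (rule module_homI)
    show "h \<in> ?F \<rightarrow>\<^sub>E carrier M"
      using assms by (auto simp: h_def free_module_carrier_iff Pi_iff subset_iff intro!: M.finsum_closed)
  next
    fix x y assume xy: "x \<in> ?F" "y \<in> ?F"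
    let ?T = "{b. x b \<noteq> \<zero>} \<union> {b. y b \<noteq> \<zero>}"
    have T: "finite ?T" "?T \<subseteq> B"
      using xy by (auto simp: free_module_carrier_iff)
    have sub: "{b. (x \<oplus>\<^bsub>free_module R B\<^esub> y) b \<noteq> \<zero>} \<subseteq> ?T"
      by (auto simp: free_module_simps)
    have "h (x \<oplus>\<^bsub>free_module R B\<^esub> y) =
        (\<Oplus>\<^bsub>M\<^esub>b\<in>?T. x b \<odot>\<^bsub>M\<^esub> \<phi> b \<oplus>\<^bsub>M\<^esub> y b \<odot>\<^bsub>M\<^esub> \<phi> b)"
      unfolding h[OF F.add.m_closed[simplified, OF xy] T(1) sub T(2)]
      using assms xy T
      by (intro M.finsum_cong') (auto simp: free_module_carrier_iff free_module_simps Pi_iff smult_l_distr subset_iff)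
    also have "\<dots> = (\<Oplus>\<^bsub>M\<^esub>b\<in>?T. x b \<odot>\<^bsub>M\<^esub> \<phi> b) \<oplus>\<^bsub>M\<^esub> (\<Oplus>\<^bsub>M\<^esub>b\<in>?T. y b \<odot>\<^bsub>M\<^esub> \<phi> b)"
      using assms xy T
      by (intro M.finsum_addf) (auto simp: free_module_carrier_iff Pi_iff subset_iff)
    also have "\<dots> = h x \<oplus>\<^bsub>M\<^esub> h y"
      using h[OF xy(1) T(1) _ T(2)] h[OF xy(2) T(1) _ T(2)] by simp
    finally show "h (x \<oplus>\<^bsub>free_module R B\<^esub> y) = h x \<oplus>\<^bsub>M\<^esub> h y" .
  next
    fix a x assume ax: "a \<in> carrier R" "x \<in> ?F"
    let ?T = "{b. x b \<noteq> \<zero>}"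
    have T: "finite ?T" "?T \<subseteq> B"
      using ax by (auto simp: free_module_carrier_iff)
    have sub: "{b. (a \<odot>\<^bsub>free_module R B\<^esub> x) b \<noteq> \<zero>} \<subseteq> ?T"
      using ax by (auto simp: free_module_simps)
    have "h (a \<odot>\<^bsub>free_module R B\<^esub> x) = (\<Oplus>\<^bsub>M\<^esub>b\<in>?T. a \<odot>\<^bsub>M\<^esub> (x b \<odot>\<^bsub>M\<^esub> \<phi> b))"
      unfolding h[OF F.smult_closed[OF ax] T(1) sub T(2)]
      using assms ax T
      by (intro M.finsum_cong') (auto simp: free_module_carrier_iff free_module_simps Pi_iff smult_assoc1 subset_iff)
    also have "\<dots> = a \<odot>\<^bsub>M\<^esub> h x"
      unfolding h[OF ax(2) T(1) subset_refl T(2)]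
      using assms ax T
      by (intro finsum_smult_ldistr[symmetric]) (auto simp: free_module_carrier_iff Pi_iff subset_iff)
    finally show "h (a \<odot>\<^bsub>free_module R B\<^esub> x) = a \<odot>\<^bsub>M\<^esub> h x" .
  qed
  moreover have "\<forall>b\<in>B. h (unit_vector R b) = \<phi> b"
  proof
    fix b assume b: "b \<in> B"
    have "{c. unit_vector R b c \<noteq> \<zero>} \<subseteq> {b}"
      by (auto simp: unit_vector_def)
    with b have "h (unit_vector R b) = (\<Oplus>\<^bsub>M\<^esub>c\<in>{b}. unit_vector R b c \<odot>\<^bsub>M\<^esub> \<phi> c)"
      by (intro h) (auto simp: unit_vector_closed)
    with assms b show "h (unit_vector R b) = \<phi> b"
      by (auto simp: unit_vector_def Pi_iff)
  qed
  ultimately show ?thesis by blast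
qed

text \<open>Projectivity in the form used below: a relation compatible with the module operations
  that has a witness at every basis vector contains the graph of a homomorphism. Homotopies, lifts
  along surjections and lifts of maps into R / J are all instances for a suitable
  \<open>Q\<close>.\<close>

lemma free_module_hom_of_relation:
  fixes R (structure) and M :: "('r, 'm) module"
  assumes "module R M"
    and unit: "\<And>b. b \<in> B \<Longrightarrow> \<exists>v\<in>carrier M. Q (unit_vector R b) v"
    and zero: "Q \<zero>\<^bsub>free_module R B\<^esub> \<zero>\<^bsub>M\<^esub>"
    and add: "\<And>x y u v. \<lbrakk>x \<in> carrier (free_module R B); y \<in> carrier (free_module R B);
      u \<in> carrier M; v \<in> carrier M; Q x u; Q y v\<rbrakk> \<Longrightarrow> Q (x \<oplus>\<^bsub>free_module R B\<^esub> y) (u \<oplus>\<^bsub>M\<^esub> v)"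
    and smult: "\<And>a x u. \<lbrakk>a \<in> carrier R; x \<in> carrier (free_module R B); u \<in> carrier M; Q x u\<rbrakk> \<Longrightarrow>
      Q (a \<odot>\<^bsub>free_module R B\<^esub> x) (a \<odot>\<^bsub>M\<^esub> u)"
  shows "\<exists>h\<in>module_hom R (free_module R B) M. \<forall>x\<in>carrier (free_module R B). Q x (h x)"
proof -
  interpret module R M by fact
  interpret F: module R "free_module R B" by (rule free_module_module)
  obtain \<phi> where \<phi>: "\<And>b. b \<in> B \<Longrightarrow> \<phi> b \<in> carrier M \<and> Q (unit_vector R b) (\<phi> b)"
    using unit by metis
  then obtain h where h: "h \<in> module_hom R (free_module R B) M" "\<And>b. b \<in> B \<Longrightarrow> h (unit_vector R b) = \<phi> b"
    using free_module_hom_exists[OF module_axioms, of \<phi> B] by (auto simp: Pi_iff)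
  have "Q x (h x)" if "x \<in> carrier (free_module R B)" for x
    using that
  proof (induction rule: free_module_induct)
    case zero
    then show ?case
      using assms(3) module_hom_zero[OF F.module_axioms module_axioms h(1)] by simp
  next
    case (add a b y)
    then show ?case
      using \<phi>[of b] h unit_vector_closed[of b B]
      by (simp add: module_hom_add module_hom_smult module_hom_closed smult assms(4))
  qed
  with h(1) show ?thesis by blast
qed

section \<open>Supports\<close>

text \<open>Fractions are equivalence classes, so the direction from right to left compares two
  whole sets; an element killing \<open>m\<close> is multiplied into the denominators to match their
  members.\<close>

lemma fraction_eq_zero_iff:
  assumes "module R M" "primeideal \<pp> R" "m \<in> carrier M" "s \<in> carrier R - \<pp>"
  shows "fraction (carrier R - \<pp>) M m s = fraction (carrier R - \<pp>) M \<zero>\<^bsub>M\<^esub> \<one>\<^bsub>R\<^esub> \<longleftrightarrow>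
    (\<exists>u\<in>carrier R - \<pp>. u \<odot>\<^bsub>M\<^esub> m = \<zero>\<^bsub>M\<^esub>)"
proof
  interpret M: module R M by fact
  interpret \<pp>: primeideal \<pp> R by fact
  let ?S = "carrier R - \<pp>"
  have one: "\<one>\<^bsub>R\<^esub> \<in> ?S"
    using \<pp>.I_notcarr \<pp>.one_imp_carrier by auto
  have mult: "u \<otimes>\<^bsub>R\<^esub> v \<in> ?S" if "u \<in> ?S" "v \<in> ?S" for u v
    using that \<pp>.I_prime by blast
  {
    assume eq: "fraction ?S M m s = fraction ?S M \<zero>\<^bsub>M\<^esub> \<one>\<^bsub>R\<^esub>"
    have "(m, s) \<in> fraction ?S M m s"
      using one assms by (auto simp: fraction_def)
    then show "\<exists>u\<in>?S. u \<odot>\<^bsub>M\<^esub> m = \<zero>\<^bsub>M\<^esub>"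
      unfolding eq using assms by (auto simp: fraction_def)
  next
    assume "\<exists>u\<in>?S. u \<odot>\<^bsub>M\<^esub> m = \<zero>\<^bsub>M\<^esub>"
    then obtain u where u: "u \<in> ?S" "u \<odot>\<^bsub>M\<^esub> m = \<zero>\<^bsub>M\<^esub>" by blast
    have "(\<exists>v\<in>?S. v \<odot>\<^bsub>M\<^esub> (t \<odot>\<^bsub>M\<^esub> m) = v \<odot>\<^bsub>M\<^esub> (s \<odot>\<^bsub>M\<^esub> n)) \<longleftrightarrow>
        (\<exists>v\<in>?S. v \<odot>\<^bsub>M\<^esub> (t \<odot>\<^bsub>M\<^esub> \<zero>\<^bsub>M\<^esub>) = v \<odot>\<^bsub>M\<^esub> (\<one>\<^bsub>R\<^esub> \<odot>\<^bsub>M\<^esub> n))"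
      if nt: "n \<in> carrier M" "t \<in> ?S" for n t
    proof
      assume "\<exists>v\<in>?S. v \<odot>\<^bsub>M\<^esub> (t \<odot>\<^bsub>M\<^esub> m) = v \<odot>\<^bsub>M\<^esub> (s \<odot>\<^bsub>M\<^esub> n)"
      then obtain v where v: "v \<in> ?S" "v \<odot>\<^bsub>M\<^esub> (t \<odot>\<^bsub>M\<^esub> m) = v \<odot>\<^bsub>M\<^esub> (s \<odot>\<^bsub>M\<^esub> n)" by blast
      \<comment> \<open>The new multiplier is the product of \<open>u\<close>, which kills
        \<open>m\<close>, of \<open>v\<close>, which witnesses the equality, and of the denominator
        \<open>s\<close>.\<close>
      have "(u \<otimes>\<^bsub>R\<^esub> v \<otimes>\<^bsub>R\<^esub> s) \<odot>\<^bsub>M\<^esub> n = u \<odot>\<^bsub>M\<^esub> (v \<odot>\<^bsub>M\<^esub> (s \<odot>\<^bsub>M\<^esub> n))"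
        using u v nt assms by (simp add: M.smult_assoc1)
      also have "\<dots> = u \<odot>\<^bsub>M\<^esub> (v \<odot>\<^bsub>M\<^esub> (t \<odot>\<^bsub>M\<^esub> m))"
        by (simp only: v(2))
      also have "\<dots> = (v \<otimes>\<^bsub>R\<^esub> t) \<odot>\<^bsub>M\<^esub> (u \<odot>\<^bsub>M\<^esub> m)"
        using u(1) v(1) nt assms by (simp add: M.smult_assoc1[symmetric] M.m_ac)
      also have "\<dots> = \<zero>\<^bsub>M\<^esub>"
        using u v nt by simp
      finally show "\<exists>v\<in>?S. v \<odot>\<^bsub>M\<^esub> (t \<odot>\<^bsub>M\<^esub> \<zero>\<^bsub>M\<^esub>) = v \<odot>\<^bsub>M\<^esub> (\<one>\<^bsub>R\<^esub> \<odot>\<^bsub>M\<^esub> n)"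
        using mult[OF mult[OF u(1) v(1)] assms(4)] nt by (intro bexI) auto
    next
      assume "\<exists>v\<in>?S. v \<odot>\<^bsub>M\<^esub> (t \<odot>\<^bsub>M\<^esub> \<zero>\<^bsub>M\<^esub>) = v \<odot>\<^bsub>M\<^esub> (\<one>\<^bsub>R\<^esub> \<odot>\<^bsub>M\<^esub> n)"
      then obtain v where v: "v \<in> ?S" "v \<odot>\<^bsub>M\<^esub> n = \<zero>\<^bsub>M\<^esub>"
        using nt by auto
      have "(u \<otimes>\<^bsub>R\<^esub> v) \<odot>\<^bsub>M\<^esub> (t \<odot>\<^bsub>M\<^esub> m) = (v \<otimes>\<^bsub>R\<^esub> t) \<odot>\<^bsub>M\<^esub> (u \<odot>\<^bsub>M\<^esub> m)"
        using u(1) v(1) nt assms by (simp add: M.smult_assoc1[symmetric] M.m_ac)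
      moreover have "(u \<otimes>\<^bsub>R\<^esub> v) \<odot>\<^bsub>M\<^esub> (s \<odot>\<^bsub>M\<^esub> n) = (u \<otimes>\<^bsub>R\<^esub> s) \<odot>\<^bsub>M\<^esub> (v \<odot>\<^bsub>M\<^esub> n)"
        using u(1) v(1) nt assms by (simp add: M.smult_assoc1[symmetric] M.m_ac)
      ultimately show "\<exists>v\<in>?S. v \<odot>\<^bsub>M\<^esub> (t \<odot>\<^bsub>M\<^esub> m) = v \<odot>\<^bsub>M\<^esub> (s \<odot>\<^bsub>M\<^esub> n)"
        using mult[OF u(1) v(1)] u v nt assms by (intro bexI[of _ "u \<otimes>\<^bsub>R\<^esub> v"]) auto
    qed
    then show "fraction ?S M m s = fraction ?S M \<zero>\<^bsub>M\<^esub> \<one>\<^bsub>R\<^esub>"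
      unfolding fraction_def by blast
  }
qed

text \<open>Whether m/s vanishes does not depend on \<open>s\<close>, so the support can be read off
  from annihilators of elements. After this, \<open>localized_module\<close> is no longer
  unfolded.\<close>

lemma Supp_iff:
  assumes "module R M"
  shows "\<pp> \<in> Supp R M \<longleftrightarrow>
    primeideal \<pp> R \<and> (\<exists>m\<in>carrier M. \<forall>s\<in>carrier R - \<pp>. s \<odot>\<^bsub>M\<^esub> m \<noteq> \<zero>\<^bsub>M\<^esub>)"
proof (cases "primeideal \<pp> R")
  case False
  then show ?thesis by (simp add: Supp_def Spec_def)
next
  case True
  interpret M: module R M by fact
  interpret \<pp>: primeideal \<pp> R by fact
  let ?S = "carrier R - \<pp>"
  have one: "\<one>\<^bsub>R\<^esub> \<in> ?S"
    using \<pp>.I_notcarr \<pp>.one_imp_carrier by auto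
  have "nonzero_module (localized_module R ?S M) \<longleftrightarrow>
    (\<exists>m\<in>carrier M. \<exists>s\<in>?S. fraction ?S M m s \<noteq> fraction ?S M \<zero>\<^bsub>M\<^esub> \<one>\<^bsub>R\<^esub>)"
  proof -
    let ?L = "carrier (localized_module R ?S M)" and ?z = "fraction ?S M \<zero>\<^bsub>M\<^esub> \<one>\<^bsub>R\<^esub>"
    have L: "?L = {fraction ?S M m s | m s. m \<in> carrier M \<and> s \<in> ?S}"
      by (simp add: localized_module_def)
    have "?z \<in> ?L"
      unfolding L using one M.zero_closed by blast
    then have "?L \<noteq> {?z} \<longleftrightarrow> (\<exists>X\<in>?L. X \<noteq> ?z)"
      by blast
    then show ?thesis
      unfolding nonzero_module_def L by (simp add: localized_module_def) blast
  qed
  also have "\<dots> \<longleftrightarrow> (\<exists>m\<in>carrier M. \<exists>s\<in>?S. \<not> (\<exists>u\<in>?S. u \<odot>\<^bsub>M\<^esub> m = \<zero>\<^bsub>M\<^esub>))"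
    using fraction_eq_zero_iff[OF assms True] by blast
  finally show ?thesis
    using True one by (auto simp: Supp_def Spec_def)
qed

section \<open>Quotient modules\<close>

lemma (in module) submoduleI':
  assumes "H \<subseteq> carrier M" "\<zero>\<^bsub>M\<^esub> \<in> H"
    and "\<And>x y. x \<in> H \<Longrightarrow> y \<in> H \<Longrightarrow> x \<oplus>\<^bsub>M\<^esub> y \<in> H"
    and "\<And>a x. a \<in> carrier R \<Longrightarrow> x \<in> H \<Longrightarrow> a \<odot>\<^bsub>M\<^esub> x \<in> H"
  shows "submodule H R M"
proof (rule submoduleI[OF assms(1,2) _ assms(3,4)])
  fix x assume "x \<in> H"
  with assms(1) assms(4)[of "\<ominus> \<one>" x] show "\<ominus>\<^bsub>M\<^esub> x \<in> H"
    by (auto simp: smult_l_minus)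
qed

lemma submodule_abelian_subgroup:
  assumes "module R M" "submodule K R M"
  shows "abelian_subgroup K M"
proof -
  interpret M: module R M by fact
  interpret K: submodule K R M by fact
  show ?thesis
    by (intro abelian_subgroupI3 additive_subgroup.intro K.subgroup_axioms M.abelian_group_axioms)
qed

text \<open>The scalar action is defined as a union of cosets over all representatives; these cosets
  coincide because \<open>K\<close> is stable under scalars.\<close>

lemma quotient_module_smult_coset:
  fixes M :: "('r, 'm) module"
  assumes "module R M" "submodule K R M" "a \<in> carrier R" "x \<in> carrier M"
  shows "a \<odot>\<^bsub>quotient_module M K\<^esub> (K +>\<^bsub>M\<^esub> x) = K +>\<^bsub>M\<^esub> (a \<odot>\<^bsub>M\<^esub> x)"
proof -
  interpret M: module R M by fact
  interpret K: submodule K R M by fact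
  interpret K': abelian_subgroup K M
    using assms by (intro submodule_abelian_subgroup)
  have "K +>\<^bsub>M\<^esub> (a \<odot>\<^bsub>M\<^esub> y) = K +>\<^bsub>M\<^esub> (a \<odot>\<^bsub>M\<^esub> x)" if "y \<in> K +>\<^bsub>M\<^esub> x" for y
  proof -
    from that obtain k where k: "k \<in> K" "y = k \<oplus>\<^bsub>M\<^esub> x"
      by (auto simp: a_r_coset_def')
    have "a \<odot>\<^bsub>M\<^esub> y = a \<odot>\<^bsub>M\<^esub> k \<oplus>\<^bsub>M\<^esub> a \<odot>\<^bsub>M\<^esub> x"
      using k assms K'.a_Hcarr by (simp add: M.smult_r_distr)
    then have "a \<odot>\<^bsub>M\<^esub> y \<in> K +>\<^bsub>M\<^esub> (a \<odot>\<^bsub>M\<^esub> x)"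
      using K.smult_closed[OF assms(3) k(1)] by (auto simp: a_r_coset_def')
    then show ?thesis
      using K'.a_repr_independence'[of "a \<odot>\<^bsub>M\<^esub> y" "a \<odot>\<^bsub>M\<^esub> x"] assms by simp
  qed
  moreover have "x \<in> K +>\<^bsub>M\<^esub> x"
    using K'.a_rcos_self assms by simp
  ultimately have "(\<Union>y\<in>K +>\<^bsub>M\<^esub> x. K +>\<^bsub>M\<^esub> (a \<odot>\<^bsub>M\<^esub> y)) = K +>\<^bsub>M\<^esub> (a \<odot>\<^bsub>M\<^esub> x)"
    by blast
  then show ?thesis
    by (simp add: quotient_module_def)
qed

lemma quotient_module_module:
  fixes M :: "('r, 'm) module"
  assumes "module R M" "submodule K R M"
  shows "module R (quotient_module M K)"
proof -
  interpret M: module R M by fact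
  interpret K: abelian_subgroup K M
    using assms by (intro submodule_abelian_subgroup)
  let ?Q = "quotient_module M K"
  have carrier: "\<exists>x\<in>carrier M. X = K +>\<^bsub>M\<^esub> x" if "X \<in> carrier ?Q" for X
    using that by (auto simp: quotient_module_def A_RCOSETS_def')
  have coset: "K +>\<^bsub>M\<^esub> x \<in> carrier ?Q" if "x \<in> carrier M" for x
    using that by (auto simp: quotient_module_def A_RCOSETS_def')
  have add: "(K +>\<^bsub>M\<^esub> x) \<oplus>\<^bsub>?Q\<^esub> (K +>\<^bsub>M\<^esub> y) = K +>\<^bsub>M\<^esub> (x \<oplus>\<^bsub>M\<^esub> y)"
    if "x \<in> carrier M" "y \<in> carrier M" for x y
    using that K.a_rcos_sum by (simp add: quotient_module_def)
  note smult = quotient_module_smult_coset[OF assms]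
  have zero: "\<zero>\<^bsub>?Q\<^esub> = K +>\<^bsub>M\<^esub> \<zero>\<^bsub>M\<^esub>"
    using K.a_subset by (simp add: quotient_module_def)
  have "abelian_group ?Q"
  proof (rule abelian_groupI)
    show "X \<oplus>\<^bsub>?Q\<^esub> Y \<in> carrier ?Q" if "X \<in> carrier ?Q" "Y \<in> carrier ?Q" for X Y
      using that carrier[of X] carrier[of Y] by (auto simp: add coset)
    show "X \<oplus>\<^bsub>?Q\<^esub> Y \<oplus>\<^bsub>?Q\<^esub> W = X \<oplus>\<^bsub>?Q\<^esub> (Y \<oplus>\<^bsub>?Q\<^esub> W)"
      if "X \<in> carrier ?Q" "Y \<in> carrier ?Q" "W \<in> carrier ?Q" for X Y W
      using that carrier[of X] carrier[of Y] carrier[of W] by (auto simp: add M.a_assoc)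
    show "X \<oplus>\<^bsub>?Q\<^esub> Y = Y \<oplus>\<^bsub>?Q\<^esub> X" if "X \<in> carrier ?Q" "Y \<in> carrier ?Q" for X Y
      using that carrier[of X] carrier[of Y] by (auto simp: add M.a_comm)
    show "\<zero>\<^bsub>?Q\<^esub> \<oplus>\<^bsub>?Q\<^esub> X = X" if "X \<in> carrier ?Q" for X
      using that carrier[of X] by (auto simp: add zero)
    show "\<exists>Y\<in>carrier ?Q. Y \<oplus>\<^bsub>?Q\<^esub> X = \<zero>\<^bsub>?Q\<^esub>" if X: "X \<in> carrier ?Q" for X
    proof -
      from X carrier obtain x where x: "x \<in> carrier M" "X = K +>\<^bsub>M\<^esub> x" by blast
      then show ?thesis
        by (intro bexI[of _ "K +>\<^bsub>M\<^esub> (\<ominus>\<^bsub>M\<^esub> x)"]) (auto simp: add zero coset M.l_neg)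
    qed
  qed (auto simp: zero coset)
  then show ?thesis
  proof (rule moduleI[OF M.is_cring])
    show "a \<odot>\<^bsub>?Q\<^esub> X \<in> carrier ?Q" if "a \<in> carrier R" "X \<in> carrier ?Q" for a X
      using that carrier[of X] by (auto simp: smult coset)
    show "(a \<oplus>\<^bsub>R\<^esub> b) \<odot>\<^bsub>?Q\<^esub> X = a \<odot>\<^bsub>?Q\<^esub> X \<oplus>\<^bsub>?Q\<^esub> b \<odot>\<^bsub>?Q\<^esub> X"
      if "a \<in> carrier R" "b \<in> carrier R" "X \<in> carrier ?Q" for a b X
      using that carrier[of X] by (auto simp: smult add M.smult_l_distr)
    show "a \<odot>\<^bsub>?Q\<^esub> (X \<oplus>\<^bsub>?Q\<^esub> Y) = a \<odot>\<^bsub>?Q\<^esub> X \<oplus>\<^bsub>?Q\<^esub> a \<odot>\<^bsub>?Q\<^esub> Y"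
      if "a \<in> carrier R" "X \<in> carrier ?Q" "Y \<in> carrier ?Q" for a X Y
      using that carrier[of X] carrier[of Y] by (auto simp: smult add M.smult_r_distr)
    show "(a \<otimes>\<^bsub>R\<^esub> b) \<odot>\<^bsub>?Q\<^esub> X = a \<odot>\<^bsub>?Q\<^esub> (b \<odot>\<^bsub>?Q\<^esub> X)"
      if "a \<in> carrier R" "b \<in> carrier R" "X \<in> carrier ?Q" for a b X
      using that carrier[of X] by (auto simp: smult M.smult_assoc1)
    show "\<one>\<^bsub>R\<^esub> \<odot>\<^bsub>?Q\<^esub> X = X" if "X \<in> carrier ?Q" for X
      using that carrier[of X] by (auto simp: smult)
  qed
qed

lemma coset_eq_submodule_iff:
  assumes "module R M" "submodule K R M" "x \<in> carrier M"
  shows "K +>\<^bsub>M\<^esub> x = K \<longleftrightarrow> x \<in> K"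
proof -
  interpret M: module R M by fact
  interpret K: abelian_subgroup K M
    using assms by (intro submodule_abelian_subgroup)
  show ?thesis
    using M.a_coset_join1[of K x] M.a_coset_join2[of x K] K.a_subgroup assms(3) by blast
qed

lemma nonzero_quotient_module_iff:
  fixes M :: "('r, 'm) module"
  assumes "module R M" "submodule K R M"
  shows "nonzero_module (quotient_module M K) \<longleftrightarrow> \<not> carrier M \<subseteq> K"
proof -
  interpret M: module R M by fact
  have "carrier (quotient_module M K) = (\<lambda>x. K +>\<^bsub>M\<^esub> x) ` carrier M" "\<zero>\<^bsub>quotient_module M K\<^esub> = K"
    by (auto simp: quotient_module_def A_RCOSETS_def')
  moreover have "(\<lambda>x. K +>\<^bsub>M\<^esub> x) ` carrier M = {K} \<longleftrightarrow> (\<forall>x\<in>carrier M. K +>\<^bsub>M\<^esub> x = K)"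
    using M.zero_closed by blast
  ultimately show ?thesis
    using coset_eq_submodule_iff[OF assms] by (auto simp: nonzero_module_def)
qed

text \<open>Allows the support of Ext to be discussed with cocycles and coboundaries instead of
  cosets.\<close>

lemma Supp_quotient_module_iff:
  fixes M :: "('r, 'm) module"
  assumes "module R M" "submodule K R M"
  shows "\<pp> \<in> Supp R (quotient_module M K) \<longleftrightarrow>
    primeideal \<pp> R \<and> (\<exists>x\<in>carrier M. \<forall>s\<in>carrier R - \<pp>. s \<odot>\<^bsub>M\<^esub> x \<notin> K)"
proof -
  interpret M: module R M by fact
  have "carrier (quotient_module M K) = (\<lambda>x. K +>\<^bsub>M\<^esub> x) ` carrier M"
       "\<zero>\<^bsub>quotient_module M K\<^esub> = K"
    by (auto simp: quotient_module_def A_RCOSETS_def')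
  then show ?thesis
    using coset_eq_submodule_iff[OF assms] quotient_module_smult_coset[OF assms]
    by (simp add: Supp_iff[OF quotient_module_module[OF assms]])
qed

section \<open>Cohomology of the dual of a free resolution\<close>

lemma Hom_module_module:
  assumes "module R M" "module R N"
  shows "module R (Hom_module R M N)"
proof -
  interpret M: module R M by fact
  interpret N: module R N by fact
  have add: "(\<lambda>x\<in>carrier M. f x \<oplus>\<^bsub>N\<^esub> g x) \<in> module_hom R M N"
    if "f \<in> module_hom R M N" "g \<in> module_hom R M N" for f g
    using that
    by (intro module_homI)
      (auto simp: module_hom_closed module_hom_add module_hom_smult N.smult_r_distr N.a_ac)
  have smult: "(\<lambda>x\<in>carrier M. a \<odot>\<^bsub>N\<^esub> f x) \<in> module_hom R M N"
    if "a \<in> carrier R" "f \<in> module_hom R M N" for a f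
    using that
    by (intro module_homI)
      (auto simp: module_hom_closed module_hom_add module_hom_smult N.smult_r_distr
        N.smult_assoc1[symmetric] M.m_comm)
  have zero: "(\<lambda>x\<in>carrier M. \<zero>\<^bsub>N\<^esub>) \<in> module_hom R M N"
    by (intro module_homI) auto
  \<comment> \<open>Extensionality of homomorphisms makes \<open>restrict\<close> act trivially, so
    that adding zero and multiplying by one return the same HOL function.\<close>
  have ext: "(\<lambda>x\<in>carrier M. f x) = f" if "f \<in> module_hom R M N" for f
    using that by (auto simp: module_hom_def PiE_def extensional_restrict)
  show ?thesis
  proof (rule moduleI)
    show "abelian_group (Hom_module R M N)"
    proof (rule abelian_groupI)
      fix f assume f: "f \<in> carrier (Hom_module R M N)"
      then have "(\<lambda>x\<in>carrier M. (\<ominus>\<^bsub>R\<^esub> \<one>\<^bsub>R\<^esub>) \<odot>\<^bsub>N\<^esub> f x) \<in> carrier (Hom_module R M N)"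
        using smult by (simp add: Hom_module_def)
      with f show "\<exists>g\<in>carrier (Hom_module R M N).
          g \<oplus>\<^bsub>Hom_module R M N\<^esub> f = \<zero>\<^bsub>Hom_module R M N\<^esub>"
        by (intro bexI[of _ "\<lambda>x\<in>carrier M. (\<ominus>\<^bsub>R\<^esub> \<one>\<^bsub>R\<^esub>) \<odot>\<^bsub>N\<^esub> f x"])
          (auto simp: Hom_module_def N.smult_l_minus N.l_neg module_hom_closed intro!: restrict_ext)
    qed (auto simp: Hom_module_def add zero ext module_hom_closed N.a_ac cong: restrict_cong)
  qed (auto simp: Hom_module_def M.is_cring smult ext module_hom_closed N.smult_l_distr
      N.smult_r_distr N.smult_assoc1 cong: restrict_cong)
qed

lemma zero_module_hom:
  assumes "module R M" "module R N"
  shows "(\<lambda>x\<in>carrier M. \<zero>\<^bsub>N\<^esub>) \<in> module_hom R M N"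
proof -
  interpret M: module R M by fact
  interpret N: module R N by fact
  show ?thesis by (rule module_homI) auto
qed

text \<open>The resolution is arbitrary, with bases of any cardinality. Everything proved here
  applies to the one picked by \<open>some_free_resolution\<close>, so two resolutions never have to
  be compared.\<close>

locale resolved_module = module R M
  for R :: "('r, 'e) ring_scheme" (structure) and M :: "('r, 'm) module" (structure) +
  fixes B :: "nat \<Rightarrow> 'b set" and d :: "nat \<Rightarrow> ('b \<Rightarrow> 'r) \<Rightarrow> 'b \<Rightarrow> 'r" and \<epsilon> :: "('b \<Rightarrow> 'r) \<Rightarrow> 'm"
  assumes resolution: "free_resolution R M B d \<epsilon>"
begin

abbreviation F :: "nat \<Rightarrow> ('r, 'b \<Rightarrow> 'r) module" where
  "F i \<equiv> free_module R (B i)"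

lemma d_hom: "d i \<in> module_hom R (F (Suc i)) (F i)"
  and augmentation_hom: "\<epsilon> \<in> module_hom R (F 0) M"
  and augmentation_surj: "\<epsilon> ` carrier (F 0) = carrier M"
  using resolution by (simp_all add: free_resolution_def)

lemmas d_closed = module_hom_closed[OF d_hom]
lemmas augmentation_closed = module_hom_closed[OF augmentation_hom]

lemma augmentation_exact:
  assumes "x \<in> carrier (F 0)" "\<epsilon> x = \<zero>\<^bsub>M\<^esub>"
  shows "\<exists>y\<in>carrier (F (Suc 0)). d 0 y = x"
proof -
  have "d 0 ` carrier (F (Suc 0)) = {x \<in> carrier (F 0). \<epsilon> x = \<zero>\<^bsub>M\<^esub>}"
    using resolution by (simp add: free_resolution_def)
  with assms have "x \<in> d 0 ` carrier (F (Suc 0))" by simp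
  then show ?thesis by blast
qed

lemma d_exact:
  assumes "x \<in> carrier (F (Suc i))" "d i x = \<zero>\<^bsub>F i\<^esub>"
  shows "\<exists>y\<in>carrier (F (Suc (Suc i))). d (Suc i) y = x"
proof -
  have "x \<in> d (Suc i) ` carrier (F (Suc (Suc i)))"
    using resolution assms unfolding free_resolution_def by blast
  then show ?thesis by blast
qed

lemma augmentation_d: "x \<in> carrier (F (Suc 0)) \<Longrightarrow> \<epsilon> (d 0 x) = \<zero>\<^bsub>M\<^esub>"
proof -
  have "d 0 ` carrier (F (Suc 0)) = {x \<in> carrier (F 0). \<epsilon> x = \<zero>\<^bsub>M\<^esub>}"
    using resolution by (simp add: free_resolution_def)
  then show "x \<in> carrier (F (Suc 0)) \<Longrightarrow> \<epsilon> (d 0 x) = \<zero>\<^bsub>M\<^esub>"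
    by blast
qed

lemma d_d: "x \<in> carrier (F (Suc (Suc i))) \<Longrightarrow> d i (d (Suc i) x) = \<zero>\<^bsub>F i\<^esub>"
  using resolution unfolding free_resolution_def by blast

lemma Hom_cocycles_iff:
  "f \<in> Hom_cocycles R B d N i \<longleftrightarrow>
     f \<in> module_hom R (F i) N \<and> (\<forall>x\<in>carrier (F (Suc i)). f (d i x) = \<zero>\<^bsub>N\<^esub>)"
  unfolding Hom_cocycles_def Hom_module_def compose_def
  by (auto simp: fun_eq_iff restrict_def)

lemma Hom_coboundaries_0: "Hom_coboundaries R B d N 0 = {\<lambda>x\<in>carrier (F 0). \<zero>\<^bsub>N\<^esub>}"
  by (simp add: Hom_coboundaries_def Hom_module_def)

lemma Hom_coboundaries_Suc:
  "Hom_coboundaries R B d N (Suc i) =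
     (\<lambda>f. compose (carrier (F (Suc i))) f (d i)) ` module_hom R (F i) N"
  by (simp add: Hom_coboundaries_def)

lemma coboundary_in_cocycles:
  assumes "module R N" "f \<in> Hom_coboundaries R B d N i"
  shows "f \<in> Hom_cocycles R B d N i"
proof -
  interpret N: module R N by fact
  show ?thesis
  proof (cases i)
    case 0
    with assms(2) show ?thesis
      using d_closed[of _ 0] zero_module_hom[OF free_module_module assms(1)]
      by (auto simp: Hom_coboundaries_0 Hom_cocycles_iff)
  next
    case (Suc j)
    with assms(2) obtain g where g: "g \<in> module_hom R (F j) N" "f = compose (carrier (F i)) g (d j)"
      by (auto simp: Hom_coboundaries_Suc)
    have "f (d i x) = \<zero>\<^bsub>N\<^esub>" if "x \<in> carrier (F (Suc i))" for x
      using that d_closed[of x i] d_d[of x j] module_hom_zero[OF free_module_module assms(1) g(1)]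
      by (simp add: g(2) compose_eq Suc)
    moreover have "f \<in> module_hom R (F i) N"
      unfolding g(2) using compose_module_hom[OF free_module_module g(1) d_hom] by (simp add: Suc)
    ultimately show ?thesis
      by (simp add: Hom_cocycles_iff)
  qed
qed

text \<open>The two conditions under which \<open>quotient_module\<close> is a genuine module in the
  definition of \<open>Hom_cohomology\<close>.\<close>

lemma Hom_cohomology_submodules:
  fixes i
  assumes "module R N"
  defines "Z \<equiv> (Hom_module R (F i) N)\<lparr>carrier := Hom_cocycles R B d N i\<rparr>"
  shows "module R Z" and "submodule (Hom_coboundaries R B d N i) R Z"
proof -
  interpret N: module R N by fact
  interpret H: module R "Hom_module R (F i) N"
    by (intro Hom_module_module free_module_module assms)
  have zero: "(\<lambda>x\<in>carrier (F i). \<zero>\<^bsub>N\<^esub>) \<in> module_hom R (F i) N" for i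
    by (rule zero_module_hom[OF free_module_module assms(1)])
  have "submodule (Hom_cocycles R B d N i) R (Hom_module R (F i) N)"
  proof (rule H.submoduleI')
    show "Hom_cocycles R B d N i \<subseteq> carrier (Hom_module R (F i) N)"
      by (auto simp: Hom_cocycles_iff Hom_module_def)
    show "\<zero>\<^bsub>Hom_module R (F i) N\<^esub> \<in> Hom_cocycles R B d N i"
      using zero by (auto simp: Hom_cocycles_iff Hom_module_def d_closed)
    fix f assume f: "f \<in> Hom_cocycles R B d N i"
    {
      fix g assume g: "g \<in> Hom_cocycles R B d N i"
      then show "f \<oplus>\<^bsub>Hom_module R (F i) N\<^esub> g \<in> Hom_cocycles R B d N i"
        using f H.add.m_closed[of f g]
        by (simp add: Hom_cocycles_iff Hom_module_def d_closed)
    next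
      fix a assume a: "a \<in> carrier R"
      then show "a \<odot>\<^bsub>Hom_module R (F i) N\<^esub> f \<in> Hom_cocycles R B d N i"
        using f H.smult_closed[of a f]
        by (simp add: Hom_cocycles_iff Hom_module_def d_closed)
    }
  qed
  then show Z: "module R Z"
    unfolding Z_def by (rule submodule.submodule_is_module) (rule H.module_axioms)
  interpret Z: module R Z by (rule Z)
  show "submodule (Hom_coboundaries R B d N i) R Z"
  proof (rule Z.submoduleI')
    show "Hom_coboundaries R B d N i \<subseteq> carrier Z"
      using coboundary_in_cocycles[OF assms(1)] by (auto simp: Z_def)
    show "\<zero>\<^bsub>Z\<^esub> \<in> Hom_coboundaries R B d N i"
    proof (cases i)
      case (Suc j)
      have "compose (carrier (F i)) (\<lambda>x\<in>carrier (F j). \<zero>\<^bsub>N\<^esub>) (d j) = (\<lambda>x\<in>carrier (F i). \<zero>\<^bsub>N\<^esub>)"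
        using d_closed by (auto simp: compose_def Suc intro!: restrict_ext)
      then show ?thesis
        using zero[of j] by (simp add: Z_def Hom_module_def Suc Hom_coboundaries_Suc image_iff) metis
    qed (simp add: Z_def Hom_module_def Hom_coboundaries_0)
    fix f assume f: "f \<in> Hom_coboundaries R B d N i"
    {
      fix g assume g: "g \<in> Hom_coboundaries R B d N i"
      show "f \<oplus>\<^bsub>Z\<^esub> g \<in> Hom_coboundaries R B d N i"
      proof (cases i)
        case (Suc j)
        interpret H': module R "Hom_module R (F j) N"
          by (intro Hom_module_module free_module_module assms)
        from f g Suc obtain f' g' where fg': "f' \<in> module_hom R (F j) N" "g' \<in> module_hom R (F j) N"
          "f = compose (carrier (F i)) f' (d j)" "g = compose (carrier (F i)) g' (d j)"
          by (auto simp: Hom_coboundaries_Suc)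
        have "f' \<oplus>\<^bsub>Hom_module R (F j) N\<^esub> g' \<in> module_hom R (F j) N"
          using H'.add.m_closed[of f' g'] fg' by (simp add: Hom_module_def)
        moreover have "f \<oplus>\<^bsub>Z\<^esub> g =
            compose (carrier (F i)) (f' \<oplus>\<^bsub>Hom_module R (F j) N\<^esub> g') (d j)"
          using d_closed by (auto simp: compose_def Suc fg' Z_def Hom_module_def intro!: restrict_ext)
        ultimately show ?thesis
          by (simp add: Suc Hom_coboundaries_Suc)
      qed (use f g in \<open>simp add: Z_def Hom_module_def Hom_coboundaries_0 restrict_def fun_eq_iff\<close>)
    next
      fix a assume a: "a \<in> carrier R"
      show "a \<odot>\<^bsub>Z\<^esub> f \<in> Hom_coboundaries R B d N i"
      proof (cases i)
        case (Suc j)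
        interpret H': module R "Hom_module R (F j) N"
          by (intro Hom_module_module free_module_module assms)
        from f Suc obtain f' where f': "f' \<in> module_hom R (F j) N"
          "f = compose (carrier (F i)) f' (d j)"
          by (auto simp: Hom_coboundaries_Suc)
        have "a \<odot>\<^bsub>Hom_module R (F j) N\<^esub> f' \<in> module_hom R (F j) N"
          using H'.smult_closed[of a f'] a f' by (simp add: Hom_module_def)
        moreover have "a \<odot>\<^bsub>Z\<^esub> f = compose (carrier (F i)) (a \<odot>\<^bsub>Hom_module R (F j) N\<^esub> f') (d j)"
          using d_closed by (auto simp: compose_def Suc f' Z_def Hom_module_def intro!: restrict_ext)
        ultimately show ?thesis
          by (simp add: Suc Hom_coboundaries_Suc)
      qed (use f a in \<open>simp add: Z_def Hom_module_def Hom_coboundaries_0 restrict_def fun_eq_iff\<close>)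
    }
  qed
qed

lemma nonzero_Hom_cohomology_iff:
  assumes "module R N"
  shows "nonzero_module (Hom_cohomology R B d N i) \<longleftrightarrow>
    \<not> Hom_cocycles R B d N i \<subseteq> Hom_coboundaries R B d N i"
  using nonzero_quotient_module_iff[OF Hom_cohomology_submodules[OF assms, of i]]
  by (simp add: Hom_cohomology_def)

lemma Supp_Hom_cohomology_iff:
  assumes "module R N"
  shows "\<pp> \<in> Supp R (Hom_cohomology R B d N i) \<longleftrightarrow>
    primeideal \<pp> R \<and> (\<exists>f\<in>Hom_cocycles R B d N i. \<forall>s\<in>carrier R - \<pp>.
      (\<lambda>x\<in>carrier (F i). s \<odot>\<^bsub>N\<^esub> f x) \<notin> Hom_coboundaries R B d N i)"
  using Supp_quotient_module_iff[OF Hom_cohomology_submodules[OF assms, of i], of \<pp>]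
  by (simp add: Hom_cohomology_def) (simp add: Hom_module_def)

lemma coboundaries_smult:
  assumes "module R N" "a \<in> carrier R" "c \<in> Hom_coboundaries R B d N i"
  shows "(\<lambda>x\<in>carrier (F i). a \<odot>\<^bsub>N\<^esub> c x) \<in> Hom_coboundaries R B d N i"
  using submodule.smult_closed[OF Hom_cohomology_submodules(2)[OF assms(1)] assms(2,3)]
  by (simp add: Hom_module_def)

end

section \<open>Existence of free resolutions\<close>

text \<open>Two distinct letters suffice to code a list of words as one word. This is the source of
  the claim that a free module on words is no larger than the set of words.\<close>

lemma ex_inj_list_list:
  assumes "(y :: 'a) \<noteq> z"
  shows "\<exists>e :: 'a list list \<Rightarrow> 'a list. inj e"
proof -
  \<comment> \<open>\<open>w\<close> is a prefix code, so concatenations of its code words decode uniquely.\<close>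
  define w :: "'a list \<Rightarrow> 'a list" where "w = (\<lambda>u. concat (map (\<lambda>a. [y, a]) u) @ [z])"
  have w_simps: "w [] = [z]" "w (a # u) = y # a # w u" for a u
    by (simp_all add: w_def)
  \<comment> \<open>The arbitrary tails \<open>s\<close> and \<open>t\<close> let a concatenation be
    decoded one code word at a time.\<close>
  have w_append: "u = v \<and> s = t" if "w u @ s = w v @ t" for u v s t
    using that
  proof (induction u arbitrary: v)
    case Nil
    then show ?case using assms by (cases v) (auto simp: w_simps)
  next
    case (Cons a u)
    then show ?case using assms by (cases v) (auto simp: w_simps)
  qed
  have "us = vs" if "concat (map w us) = concat (map w vs)" for us vs
    using that
  proof (induction us arbitrary: vs)
    case Nil
    then show ?case by (cases vs) (auto simp: w_def)
  next
    case (Cons u us)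
    then obtain v vs' where vs: "vs = v # vs'"
      by (cases vs) (auto simp: w_def)
    with Cons w_append[of u "concat (map w us)" v "concat (map w vs')"] show ?case by auto
  qed
  then have "inj (\<lambda>us. concat (map w us))"
    by (rule injI)
  then show ?thesis by blast
qed

text \<open>A finitely supported function is recovered from a finite list of its support points with
  their values; the point \<open>b\<close> with value \<open>f b\<close> is coded as the word
  \<open>Inl (f b) # b\<close>.\<close>

lemma ex_inj_on_finite_support:
  fixes c :: 'r
  shows "\<exists>e :: (('r + 'm) list \<Rightarrow> 'r) \<Rightarrow> ('r + 'm) list. inj_on e {f. finite {b. f b \<noteq> c}}"
proof -
  \<comment> \<open>HOL types are nonempty, so a sum type always offers two distinct
    letters.\<close>
  have "(Inl undefined :: 'r + 'm) \<noteq> Inr undefined" by simp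
  from ex_inj_list_list[OF this] obtain e :: "('r + 'm) list list \<Rightarrow> ('r + 'm) list" where e: "inj e"
    by blast
  define l where "l f = (SOME xs. set xs = {b. f b \<noteq> c})" for f :: "('r + 'm) list \<Rightarrow> 'r"
  have l: "set (l f) = {b. f b \<noteq> c}" if "finite {b. f b \<noteq> c}" for f
    unfolding l_def by (rule someI_ex) (rule finite_list[OF that])
  let ?e = "\<lambda>f. e (map (\<lambda>b. Inl (f b) # b) (l f))"
  have "f = g" if fin: "finite {b. f b \<noteq> c}" "finite {b. g b \<noteq> c}" and eq: "?e f = ?e g" for f g
  proof -
    \<comment> \<open>The support is enumerated by \<open>SOME\<close>, so the order of the list
      carries no meaning; only the set of coded pairs is compared.\<close>
    have "(\<lambda>b. Inl (f b) # b :: ('r + 'm) list) ` set (l f) = (\<lambda>b. Inl (g b) # b) ` set (l g)"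
      using injD[OF e eq] by (metis image_set)
    then have img: "(\<lambda>b. Inl (f b) # b :: ('r + 'm) list) ` {b. f b \<noteq> c} = (\<lambda>b. Inl (g b) # b) ` {b. g b \<noteq> c}"
      by (simp only: l[OF fin(1)] l[OF fin(2)])
    have f: "g b = f b" if "f b \<noteq> c" for b
    proof -
      have "(Inl (f b) # b :: ('r + 'm) list) \<in> (\<lambda>b. Inl (g b) # b) ` {b. g b \<noteq> c}"
        using that unfolding img[symmetric] by blast
      then show ?thesis by auto
    qed
    have g: "f b = g b" if "g b \<noteq> c" for b
    proof -
      have "(Inl (g b) # b :: ('r + 'm) list) \<in> (\<lambda>b. Inl (f b) # b) ` {b. f b \<noteq> c}"
        using that unfolding img by blast
      then show ?thesis by auto
    qed
    show "f = g"
      using f g by (metis ext)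
  qed
  then have "inj_on ?e {f. finite {b. f b \<noteq> c}}"
    by (auto intro: inj_onI)
  then show ?thesis by blast
qed

lemma kernel_submodule:
  assumes "module R M" "module R N" "f \<in> module_hom R M N"
  shows "submodule {x \<in> carrier M. f x = \<zero>\<^bsub>N\<^esub>} R M"
proof -
  interpret M: module R M by fact
  interpret N: module R N by fact
  show ?thesis
    using assms(3) module_hom_zero[OF assms]
    by (intro M.submoduleI') (auto simp: module_hom_add module_hom_smult)
qed

text \<open>One basis element for each element of \<open>K\<close>; the injection \<open>e\<close>
  places this basis in a prescribed type.\<close>

lemma submodule_free_cover:
  fixes N :: "('r, 'n) module" and e :: "'n \<Rightarrow> 'b"
  assumes "module R N" "submodule K R N" "inj_on e K"
  shows "\<exists>(B :: 'b set) h. h \<in> module_hom R (free_module R B) N \<and> h ` carrier (free_module R B) = K"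
proof -
  interpret N: module R N by fact
  interpret K: submodule K R N by fact
  have K: "K \<subseteq> carrier N" "\<zero>\<^bsub>N\<^esub> \<in> K"
    using K.subset K.one_closed by simp_all
  have "inv_into K e \<in> e ` K \<rightarrow> carrier N"
    using K(1) inv_into_into[of _ e K] by blast
  then obtain h where h: "h \<in> module_hom R (free_module R (e ` K)) N"
    "\<And>b. b \<in> e ` K \<Longrightarrow> h (unit_vector R b) = inv_into K e b"
    using free_module_hom_exists[OF assms(1)] by metis
  have "h x \<in> K" if "x \<in> carrier (free_module R (e ` K))" for x
    using that
  proof (induction rule: N.free_module_induct)
    case zero
    then show ?case
      using K(2) module_hom_zero[OF N.free_module_module assms(1) h(1)] by simp
  next
    case (add a b y)
    then have "h (unit_vector R b) \<in> K"
      using h(2) inv_into_into[of b e K] by simp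
    with add show ?case
      using N.submoduleE(4,5)[OF assms(2)] N.unit_vector_closed[OF add(2)]
      by (simp add: module_hom_add[OF h(1)] module_hom_smult[OF h(1)]
          module.smult_closed[OF N.free_module_module])
  qed
  moreover have "k \<in> h ` carrier (free_module R (e ` K))" if "k \<in> K" for k
  proof -
    have "h (unit_vector R (e k)) = k"
      using that h(2) assms(3) by simp
    then show ?thesis
      using N.unit_vector_closed[of "e k" "e ` K"] that by (metis imageI)
  qed
  ultimately have "h ` carrier (free_module R (e ` K)) = K"
    by blast
  with h(1) show ?thesis by blast
qed

text \<open>The new basis lies in the same type as the old one, since the kernel consists of
  finitely supported functions and injects into the index type. This keeps the whole resolution
  within one type.\<close>

lemma kernel_free_cover:
  fixes N :: "('r, 'n) module" and B :: "('r + 'm) list set"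
  assumes "module R N" "f \<in> module_hom R (free_module R B) N"
  shows "\<exists>(C :: ('r + 'm) list set) h. h \<in> module_hom R (free_module R C) (free_module R B) \<and>
    h ` carrier (free_module R C) = {x \<in> carrier (free_module R B). f x = \<zero>\<^bsub>N\<^esub>}"
proof -
  interpret N: module R N by fact
  let ?K = "{x \<in> carrier (free_module R B). f x = \<zero>\<^bsub>N\<^esub>}"
  obtain e :: "(('r + 'm) list \<Rightarrow> 'r) \<Rightarrow> ('r + 'm) list" where "inj_on e {f. finite {b. f b \<noteq> \<zero>\<^bsub>R\<^esub>}}"
    using ex_inj_on_finite_support[where 'm = 'm and c = "\<zero>\<^bsub>R\<^esub>"] by blast
  then have "inj_on e ?K"
    by (rule inj_on_subset) (auto simp: free_module_carrier_iff)
  from submodule_free_cover[OF N.free_module_module kernel_submodule[OF N.free_module_module assms] this]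
  show ?thesis .
qed

text \<open>Without it nothing would be known about the \<open>SOME\<close> in
  \<open>some_free_resolution\<close>.\<close>

lemma ex_free_resolution:
  fixes R :: "('r, 'e) ring_scheme" and M :: "('r, 'm) module"
  assumes "module R M"
  shows "\<exists>(B :: nat \<Rightarrow> ('r + 'm) list set) d \<epsilon>. free_resolution R M B d \<epsilon>"
proof -
  interpret M: module R M by fact
  \<comment> \<open>The basis in degree 0 consists of one-letter words, one for each element of
    \<open>M\<close>.\<close>
  have "inj_on (\<lambda>m. [Inr m :: 'r + 'm]) (carrier M)"
    by (auto intro: inj_onI)
  from submodule_free_cover[OF assms M.carrier_is_submodule this]
  obtain B0 :: "('r + 'm) list set" and \<epsilon> where \<epsilon>: "\<epsilon> \<in> module_hom R (free_module R B0) M"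
    "\<epsilon> ` carrier (free_module R B0) = carrier M"
    by blast
  \<comment> \<open>A triple \<open>(A, C, h)\<close> stands for a map from the free module on
    \<open>C\<close> to the one on \<open>A\<close>. \<open>P\<close> fixes the start of the
    resolution at \<open>\<epsilon>\<close>, and \<open>Q\<close> states that consecutive maps share
    a basis and are exact there, as dependent choice requires.\<close>
  define P where "P n = (\<lambda>(A :: ('r + 'm) list set, C :: ('r + 'm) list set, h). h \<in> module_hom R (free_module R C) (free_module R A) \<and>
    (n = 0 \<longrightarrow> A = B0 \<and> h ` carrier (free_module R C) =
      {x \<in> carrier (free_module R A). \<epsilon> x = \<zero>\<^bsub>M\<^esub>}))"
    for n :: nat
  define Q where "Q = (\<lambda>(A :: ('r + 'm) list set, C :: ('r + 'm) list set, h)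
    (A', C' :: ('r + 'm) list set, h'). A' = C \<and> h' ` carrier (free_module R C') =
      {x \<in> carrier (free_module R C). h x = \<zero>\<^bsub>free_module R A\<^esub>})"
  have "\<exists>x. P 0 x"
  proof -
    from kernel_free_cover[OF assms \<epsilon>(1)] obtain C :: "('r + 'm) list set" and h
      where "h \<in> module_hom R (free_module R C) (free_module R B0)"
        "h ` carrier (free_module R C) = {x \<in> carrier (free_module R B0). \<epsilon> x = \<zero>\<^bsub>M\<^esub>}"
      by blast
    then have "P 0 (B0, C, h)"
      by (simp add: P_def)
    then show ?thesis by (intro exI)
  qed
  moreover have "\<exists>y. P (Suc n) y \<and> Q x y" if "P n x" for x n
  proof (cases x)
    case (fields A C h)
    with that have "h \<in> module_hom R (free_module R C) (free_module R A)"
      by (simp add: P_def)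
    from kernel_free_cover[OF M.free_module_module this] obtain C' :: "('r + 'm) list set" and h'
      where "h' \<in> module_hom R (free_module R C') (free_module R C)"
        "h' ` carrier (free_module R C') =
          {y \<in> carrier (free_module R C). h y = \<zero>\<^bsub>free_module R A\<^esub>}"
      by blast
    then have "P (Suc n) (C, C', h') \<and> Q x (C, C', h')"
      by (simp add: P_def Q_def fields)
    then show ?thesis by (intro exI)
  qed
  ultimately obtain t where t: "\<And>n. P n (t n)" "\<And>n. Q (t n) (t (Suc n))"
    using dependent_nat_choice[of P "\<lambda>_. Q"] by metis
  define B where "B n = fst (t n)" for n
  define d where "d n = snd (snd (t n))" for n
  have tB: "t n = (B n, B (Suc n), d n)" for n
    using t(2)[of n] by (auto simp: Q_def B_def d_def split: prod.splits)
  have "free_resolution R M B d \<epsilon>"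
  proof -
    have "d i \<in> module_hom R (free_module R (B (Suc i))) (free_module R (B i))" for i
      using t(1)[of i] unfolding tB[of i] P_def by simp
    moreover have "B 0 = B0" "d 0 ` carrier (free_module R (B (Suc 0))) =
        {x \<in> carrier (free_module R (B 0)). \<epsilon> x = \<zero>\<^bsub>M\<^esub>}"
      using t(1)[of 0] unfolding tB[of 0] P_def by simp_all
    moreover have "d (Suc i) ` carrier (free_module R (B (Suc (Suc i)))) =
        {x \<in> carrier (free_module R (B (Suc i))). d i x = \<zero>\<^bsub>free_module R (B i)\<^esub>}" for i
      using t(2)[of i] unfolding tB[of i] tB[of "Suc i"] Q_def by simp
    ultimately show ?thesis
      using \<epsilon> by (simp add: free_resolution_def)
  qed
  then show ?thesis by (intro exI)
qed

lemma some_free_resolution: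
  fixes R :: "('r, 'e) ring_scheme" and M :: "('r, 'm) module"
  assumes "module R M"
  shows "\<exists>B d \<epsilon>. some_free_resolution R M = (B, d) \<and> free_resolution R M B d \<epsilon>"
proof -
  have "\<exists>x. case x of (B, d) \<Rightarrow> \<exists>\<epsilon>. free_resolution R M (B :: nat \<Rightarrow> ('r + 'm) list set) d \<epsilon>"
    using ex_free_resolution[OF assms] by auto
  from someI_ex[OF this] show ?thesis
    unfolding some_free_resolution_def by (auto split: prod.splits)
qed

section \<open>Annihilators of a module annihilate Ext\<close>

lemma (in abelian_group) minus_eq_iff_add_eq:
  assumes "x \<in> carrier G" "y \<in> carrier G" "z \<in> carrier G"
  shows "x = z \<ominus> y \<longleftrightarrow> x \<oplus> y = z"
  using assms by (metis a_minus_def add.inv_solve_right minus_closed)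

context resolved_module
begin

text \<open>On a basis vector \<open>x\<close>, the element \<open>s x - \<sigma> (d x)\<close> is a
  cycle, so exactness provides \<open>\<tau> x\<close>. The hypothesis is the homotopy identity
  restricted to boundaries, where the preceding homotopy drops out; in this form degree 0 needs no
  separate treatment.\<close>

lemma null_homotopy_step:
  assumes s: "s \<in> carrier R" and \<sigma>: "\<sigma> \<in> module_hom R (F i) (F (Suc i))"
    and \<sigma>_d: "\<And>y. y \<in> carrier (F (Suc i)) \<Longrightarrow> d i (\<sigma> (d i y)) = s \<odot>\<^bsub>F i\<^esub> d i y"
  shows "\<exists>\<tau>\<in>module_hom R (F (Suc i)) (F (Suc (Suc i))). \<forall>x\<in>carrier (F (Suc i)).
    d (Suc i) (\<tau> x) \<oplus>\<^bsub>F (Suc i)\<^esub> \<sigma> (d i x) = s \<odot>\<^bsub>F (Suc i)\<^esub> x"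
proof (rule free_module_hom_of_relation[OF free_module_module])
  interpret F: module R "F i" by (rule free_module_module)
  interpret F1: module R "F (Suc i)" by (rule free_module_module)
  interpret F2: module R "F (Suc (Suc i))" by (rule free_module_module)
  note \<sigma>_closed = module_hom_closed[OF \<sigma>]
  have \<sigma>0: "\<sigma> \<zero>\<^bsub>F i\<^esub> = \<zero>\<^bsub>F (Suc i)\<^esub>"
    by (rule module_hom_zero[OF F.module_axioms F1.module_axioms \<sigma>])
  have d0: "d j \<zero>\<^bsub>F (Suc j)\<^esub> = \<zero>\<^bsub>F j\<^esub>" for j
    by (rule module_hom_zero[OF free_module_module free_module_module d_hom])
  show "d (Suc i) \<zero>\<^bsub>F (Suc (Suc i))\<^esub> \<oplus>\<^bsub>F (Suc i)\<^esub> \<sigma> (d i \<zero>\<^bsub>F (Suc i)\<^esub>) = s \<odot>\<^bsub>F (Suc i)\<^esub> \<zero>\<^bsub>F (Suc i)\<^esub>"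
    using s by (simp add: d0 \<sigma>0)
  {
    fix b assume "b \<in> B (Suc i)"
    then have b: "unit_vector R b \<in> carrier (F (Suc i))" (is "?x \<in> _")
      by (rule unit_vector_closed)
    let ?z = "s \<odot>\<^bsub>F (Suc i)\<^esub> ?x \<ominus>\<^bsub>F (Suc i)\<^esub> \<sigma> (d i ?x)"
    have cl: "d i ?x \<in> carrier (F i)" "\<sigma> (d i ?x) \<in> carrier (F (Suc i))"
      using b by (simp_all add: d_closed \<sigma>_closed)
    have "d i ?z = s \<odot>\<^bsub>F i\<^esub> d i ?x \<ominus>\<^bsub>F i\<^esub> d i (\<sigma> (d i ?x))"
      using b s cl
      by (simp add: module_hom_minus[OF F1.module_axioms F.module_axioms d_hom]
          module_hom_smult[OF d_hom])
    also have "\<dots> = \<zero>\<^bsub>F i\<^esub>"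
      using b s cl by (simp add: \<sigma>_d a_minus_def F.r_neg)
    finally obtain v where v: "v \<in> carrier (F (Suc (Suc i)))" "d (Suc i) v = ?z"
      using d_exact[of ?z i] s b cl by auto
    then have "d (Suc i) v \<oplus>\<^bsub>F (Suc i)\<^esub> \<sigma> (d i ?x) = s \<odot>\<^bsub>F (Suc i)\<^esub> ?x"
      using F1.minus_eq_iff_add_eq[of "d (Suc i) v" "\<sigma> (d i ?x)" "s \<odot>\<^bsub>F (Suc i)\<^esub> ?x"] s b cl
      by (simp add: d_closed)
    with v(1) show "\<exists>v\<in>carrier (F (Suc (Suc i))).
        d (Suc i) v \<oplus>\<^bsub>F (Suc i)\<^esub> \<sigma> (d i ?x) = s \<odot>\<^bsub>F (Suc i)\<^esub> ?x"
      by blast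
  next
    fix x y u v
    assume *: "x \<in> carrier (F (Suc i))" "y \<in> carrier (F (Suc i))"
      "u \<in> carrier (F (Suc (Suc i)))" "v \<in> carrier (F (Suc (Suc i)))"
      "d (Suc i) u \<oplus>\<^bsub>F (Suc i)\<^esub> \<sigma> (d i x) = s \<odot>\<^bsub>F (Suc i)\<^esub> x"
      "d (Suc i) v \<oplus>\<^bsub>F (Suc i)\<^esub> \<sigma> (d i y) = s \<odot>\<^bsub>F (Suc i)\<^esub> y"
    have "s \<odot>\<^bsub>F (Suc i)\<^esub> (x \<oplus>\<^bsub>F (Suc i)\<^esub> y) = s \<odot>\<^bsub>F (Suc i)\<^esub> x \<oplus>\<^bsub>F (Suc i)\<^esub> s \<odot>\<^bsub>F (Suc i)\<^esub> y"
      using *(1,2) s by (simp add: F1.smult_r_distr)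
    then show "d (Suc i) (u \<oplus>\<^bsub>F (Suc (Suc i))\<^esub> v) \<oplus>\<^bsub>F (Suc i)\<^esub> \<sigma> (d i (x \<oplus>\<^bsub>F (Suc i)\<^esub> y)) =
        s \<odot>\<^bsub>F (Suc i)\<^esub> (x \<oplus>\<^bsub>F (Suc i)\<^esub> y)"
      unfolding *(5,6)[symmetric] using *(1-4)
      by (simp add: module_hom_add[OF d_hom] module_hom_add[OF \<sigma>] d_closed \<sigma>_closed F1.a_ac)
  next
    fix a x u
    assume *: "a \<in> carrier R" "x \<in> carrier (F (Suc i))" "u \<in> carrier (F (Suc (Suc i)))"
      "d (Suc i) u \<oplus>\<^bsub>F (Suc i)\<^esub> \<sigma> (d i x) = s \<odot>\<^bsub>F (Suc i)\<^esub> x"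
    have "s \<odot>\<^bsub>F (Suc i)\<^esub> (a \<odot>\<^bsub>F (Suc i)\<^esub> x) = a \<odot>\<^bsub>F (Suc i)\<^esub> (s \<odot>\<^bsub>F (Suc i)\<^esub> x)"
      using * s by (simp add: m_comm flip: F1.smult_assoc1)
    then show "d (Suc i) (a \<odot>\<^bsub>F (Suc (Suc i))\<^esub> u) \<oplus>\<^bsub>F (Suc i)\<^esub> \<sigma> (d i (a \<odot>\<^bsub>F (Suc i)\<^esub> x)) =
        s \<odot>\<^bsub>F (Suc i)\<^esub> (a \<odot>\<^bsub>F (Suc i)\<^esub> x)"
      unfolding *(4)[symmetric] using *(1-3)
      by (simp add: module_hom_smult[OF d_hom] module_hom_smult[OF \<sigma>] d_closed \<sigma>_closed
          F1.smult_r_distr)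
  }
qed

text \<open>The identity on boundaries does not mention the previous map, hence can serve as
  induction invariant. In degree 0 there is no previous map, and the full identity is recorded for
  use with Ext in degree 0.\<close>

lemma ex_null_homotopy:
  assumes s: "s \<in> carrier R" and ann: "\<And>m. m \<in> carrier M \<Longrightarrow> s \<odot>\<^bsub>M\<^esub> m = \<zero>\<^bsub>M\<^esub>"
  shows "\<exists>\<sigma>\<in>module_hom R (F i) (F (Suc i)).
    (\<forall>y\<in>carrier (F (Suc i)). d i (\<sigma> (d i y)) = s \<odot>\<^bsub>F i\<^esub> d i y) \<and>
    (i = 0 \<longrightarrow> (\<forall>x\<in>carrier (F 0). d 0 (\<sigma> x) = s \<odot>\<^bsub>F 0\<^esub> x))"
proof (induction i)
  case 0
  interpret F0: module R "F 0" by (rule free_module_module)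
  interpret F1: module R "F (Suc 0)" by (rule free_module_module)
  have "\<exists>\<sigma>\<in>module_hom R (F 0) (F (Suc 0)). \<forall>x\<in>carrier (F 0). d 0 (\<sigma> x) = s \<odot>\<^bsub>F 0\<^esub> x"
  proof (rule free_module_hom_of_relation[OF free_module_module])
    fix b assume "b \<in> B 0"
    then have b: "unit_vector R b \<in> carrier (F 0)"
      by (rule unit_vector_closed)
    \<comment> \<open>The only place where \<open>s\<close> annihilating \<open>M\<close> is used:
      it puts \<open>s\<close> times a basis vector into the kernel of \<open>\<epsilon>\<close>,
      hence into the image of \<open>d 0\<close>.\<close>
    then have "\<epsilon> (s \<odot>\<^bsub>F 0\<^esub> unit_vector R b) = \<zero>\<^bsub>M\<^esub>"
      using s by (simp add: module_hom_smult[OF augmentation_hom] augmentation_closed ann)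
    with b s show "\<exists>v\<in>carrier (F (Suc 0)). d 0 v = s \<odot>\<^bsub>F 0\<^esub> unit_vector R b"
      by (intro augmentation_exact) auto
  next
    show "d 0 \<zero>\<^bsub>F (Suc 0)\<^esub> = s \<odot>\<^bsub>F 0\<^esub> \<zero>\<^bsub>F 0\<^esub>"
      using s module_hom_zero[OF free_module_module free_module_module d_hom[of 0]] by simp
  qed (use s in \<open>auto simp: module_hom_add[OF d_hom] module_hom_smult[OF d_hom] F0.smult_r_distr
        F0.smult_assoc1[symmetric] m_comm\<close>)
  then obtain \<sigma> where "\<sigma> \<in> module_hom R (F 0) (F (Suc 0))"
    "\<And>x. x \<in> carrier (F 0) \<Longrightarrow> d 0 (\<sigma> x) = s \<odot>\<^bsub>F 0\<^esub> x"
    by blast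
  then show ?case
    by (intro bexI[of _ \<sigma>]) (simp_all add: d_closed)
next
  case (Suc i)
  interpret F1: module R "F (Suc i)" by (rule free_module_module)
  from Suc obtain \<sigma> where \<sigma>: "\<sigma> \<in> module_hom R (F i) (F (Suc i))"
    "\<And>y. y \<in> carrier (F (Suc i)) \<Longrightarrow> d i (\<sigma> (d i y)) = s \<odot>\<^bsub>F i\<^esub> d i y"
    by blast
  from null_homotopy_step[OF s this] obtain \<tau>
    where \<tau>: "\<tau> \<in> module_hom R (F (Suc i)) (F (Suc (Suc i)))"
    "\<And>x. x \<in> carrier (F (Suc i)) \<Longrightarrow>
      d (Suc i) (\<tau> x) \<oplus>\<^bsub>F (Suc i)\<^esub> \<sigma> (d i x) = s \<odot>\<^bsub>F (Suc i)\<^esub> x"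
    by blast
  \<comment> \<open>Evaluating the homotopy identity at a boundary removes the term with
    \<open>\<sigma>\<close>, because the square of the differential is zero.\<close>
  have "d (Suc i) (\<tau> (d (Suc i) y)) = s \<odot>\<^bsub>F (Suc i)\<^esub> d (Suc i) y"
    if "y \<in> carrier (F (Suc (Suc i)))" for y
    using that \<tau>(2)[of "d (Suc i) y"] module_hom_closed[OF \<tau>(1)]
      module_hom_zero[OF free_module_module free_module_module \<sigma>(1)]
    by (simp add: d_d d_closed)
  with \<tau>(1) show ?case by blast
qed

text \<open>Apply the cocycle \<open>f\<close> to the homotopy identity: the term through
  \<open>\<tau>\<close> dies, and \<open>s f\<close> is left as the coboundary of
  \<open>f \<circ> \<sigma>\<close>.\<close>

lemma annihilator_cocycle_coboundary:
  assumes s: "s \<in> carrier R" and ann: "\<And>m. m \<in> carrier M \<Longrightarrow> s \<odot>\<^bsub>M\<^esub> m = \<zero>\<^bsub>M\<^esub>"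
    and N: "module R N" and f: "f \<in> Hom_cocycles R B d N i"
  shows "(\<lambda>x\<in>carrier (F i). s \<odot>\<^bsub>N\<^esub> f x) \<in> Hom_coboundaries R B d N i"
proof -
  interpret N: module R N by fact
  have f: "f \<in> module_hom R (F i) N" "\<And>x. x \<in> carrier (F (Suc i)) \<Longrightarrow> f (d i x) = \<zero>\<^bsub>N\<^esub>"
    using f by (auto simp: Hom_cocycles_iff)
  show ?thesis
  proof (cases i)
    case 0
    obtain \<sigma> where \<sigma>: "\<sigma> \<in> module_hom R (F 0) (F (Suc 0))"
      "\<And>x. x \<in> carrier (F 0) \<Longrightarrow> d 0 (\<sigma> x) = s \<odot>\<^bsub>F 0\<^esub> x"
      using ex_null_homotopy[OF s ann, of 0] by blast
    have "s \<odot>\<^bsub>N\<^esub> f x = \<zero>\<^bsub>N\<^esub>" if "x \<in> carrier (F 0)" for x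
      using f(2)[of "\<sigma> x"] that \<sigma>(2) module_hom_closed[OF \<sigma>(1)] s f(1)
      by (simp add: 0 module_hom_smult)
    then show ?thesis
      by (auto simp: 0 Hom_coboundaries_0)
  next
    case (Suc j)
    obtain \<sigma> where \<sigma>: "\<sigma> \<in> module_hom R (F j) (F (Suc j))"
      "\<And>y. y \<in> carrier (F (Suc j)) \<Longrightarrow> d j (\<sigma> (d j y)) = s \<odot>\<^bsub>F j\<^esub> d j y"
      using ex_null_homotopy[OF s ann, of j] by blast
    \<comment> \<open>The step lemma is called again with this very \<open>\<sigma>\<close>, because
      the invariant of \<open>ex_null_homotopy\<close> does not relate the homotopies of
      neighbouring degrees.\<close>
    obtain \<tau> where \<tau>: "\<tau> \<in> module_hom R (F (Suc j)) (F (Suc (Suc j)))"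
      "\<And>x. x \<in> carrier (F (Suc j)) \<Longrightarrow>
        d (Suc j) (\<tau> x) \<oplus>\<^bsub>F (Suc j)\<^esub> \<sigma> (d j x) = s \<odot>\<^bsub>F (Suc j)\<^esub> x"
      using null_homotopy_step[OF s \<sigma>] by blast
    have "s \<odot>\<^bsub>N\<^esub> f x = f (\<sigma> (d j x))" if x: "x \<in> carrier (F (Suc j))" for x
    proof -
      have "s \<odot>\<^bsub>N\<^esub> f x = f (d (Suc j) (\<tau> x) \<oplus>\<^bsub>F (Suc j)\<^esub> \<sigma> (d j x))"
        using f(1) x s by (simp add: Suc \<tau>(2) module_hom_smult)
      also have "\<dots> = f (d (Suc j) (\<tau> x)) \<oplus>\<^bsub>N\<^esub> f (\<sigma> (d j x))"
        using f(1) x module_hom_closed[OF \<tau>(1)] module_hom_closed[OF \<sigma>(1)]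
        by (simp add: Suc d_closed module_hom_add)
      also have "\<dots> = f (\<sigma> (d j x))"
        using f x module_hom_closed[OF \<tau>(1)] module_hom_closed[OF \<sigma>(1)]
        by (simp add: Suc d_closed module_hom_closed)
      finally show ?thesis .
    qed
    then have "(\<lambda>x\<in>carrier (F i). s \<odot>\<^bsub>N\<^esub> f x) =
        compose (carrier (F i)) (compose (carrier (F j)) f \<sigma>) (d j)"
      by (auto simp: compose_def Suc d_closed)
    moreover have "compose (carrier (F j)) f \<sigma> \<in> module_hom R (F j) N"
      using compose_module_hom[OF free_module_module _ \<sigma>(1)] f(1) by (simp add: Suc)
    ultimately show ?thesis
      by (simp add: Suc Hom_coboundaries_Suc)
  qed
qed

end

section \<open>Common annihilators of a finitely generated module outside a prime\<close>

lemma (in primeideal) notin_mult: "a \<in> carrier R - I \<Longrightarrow> b \<in> carrier R - I \<Longrightarrow> a \<otimes> b \<in> carrier R - I"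
  using I_prime by blast

lemma (in primeideal) notin_one: "\<one> \<in> carrier R - I"
  using I_notcarr one_imp_carrier by auto

text \<open>Each generator has an annihilator outside the prime; their product kills all of finitely
  many generators and stays outside.\<close>

lemma ex_annihilator_if_notin_Supp:
  assumes "module R M" "finitely_generated_module R M" "primeideal \<pp> R" "\<pp> \<notin> Supp R M"
  shows "\<exists>s\<in>carrier R - \<pp>. \<forall>m\<in>carrier M. s \<odot>\<^bsub>M\<^esub> m = \<zero>\<^bsub>M\<^esub>"
proof -
  interpret M: module R M by fact
  interpret \<pp>: primeideal \<pp> R by fact
  obtain A where A: "finite A" "A \<subseteq> carrier M"
    "\<And>x. x \<in> carrier M \<Longrightarrow> \<exists>c\<in>A \<rightarrow> carrier R. x = (\<Oplus>\<^bsub>M\<^esub>a\<in>A. c a \<odot>\<^bsub>M\<^esub> a)"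
    using assms(2) by (auto simp: finitely_generated_module_def)
  have kill: "\<exists>s\<in>carrier R - \<pp>. s \<odot>\<^bsub>M\<^esub> m = \<zero>\<^bsub>M\<^esub>" if "m \<in> carrier M" for m
    using assms(3,4) that Supp_iff[OF assms(1)] by blast
  have "\<exists>s\<in>carrier R - \<pp>. \<forall>a\<in>A. s \<odot>\<^bsub>M\<^esub> a = \<zero>\<^bsub>M\<^esub>"
    using A(1,2)
  proof (induction A rule: finite_induct)
    case empty
    then show ?case using \<pp>.notin_one by blast
  next
    case (insert a A)
    then obtain s t where st: "s \<in> carrier R - \<pp>" "\<forall>a\<in>A. s \<odot>\<^bsub>M\<^esub> a = \<zero>\<^bsub>M\<^esub>"
      "t \<in> carrier R - \<pp>" "t \<odot>\<^bsub>M\<^esub> a = \<zero>\<^bsub>M\<^esub>"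
      using kill[of a] by auto
    have "(s \<otimes>\<^bsub>R\<^esub> t) \<odot>\<^bsub>M\<^esub> b = t \<odot>\<^bsub>M\<^esub> (s \<odot>\<^bsub>M\<^esub> b)" if "b \<in> carrier M" for b
      using st that by (simp add: M.m_comm[of s t] M.smult_assoc1)
    with st insert.prems have "\<forall>b\<in>insert a A. (s \<otimes>\<^bsub>R\<^esub> t) \<odot>\<^bsub>M\<^esub> b = \<zero>\<^bsub>M\<^esub>"
      by (auto simp: M.smult_assoc1)
    with \<pp>.notin_mult[OF st(1,3)] show ?case by blast
  qed
  then obtain s where s: "s \<in> carrier R - \<pp>" "\<And>a. a \<in> A \<Longrightarrow> s \<odot>\<^bsub>M\<^esub> a = \<zero>\<^bsub>M\<^esub>"
    by blast
  have "s \<odot>\<^bsub>M\<^esub> m = \<zero>\<^bsub>M\<^esub>" if m: "m \<in> carrier M" for m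
  proof -
    obtain c where c: "c \<in> A \<rightarrow> carrier R" "m = (\<Oplus>\<^bsub>M\<^esub>a\<in>A. c a \<odot>\<^bsub>M\<^esub> a)"
      using A(3)[OF m] by blast
    have "s \<odot>\<^bsub>M\<^esub> m = (\<Oplus>\<^bsub>M\<^esub>a\<in>A. s \<odot>\<^bsub>M\<^esub> (c a \<odot>\<^bsub>M\<^esub> a))"
      unfolding c(2) using s(1) A c(1) by (intro M.finsum_smult_ldistr) auto
    also have "\<dots> = (\<Oplus>\<^bsub>M\<^esub>a\<in>A. c a \<odot>\<^bsub>M\<^esub> (s \<odot>\<^bsub>M\<^esub> a))"
      using s(1) A c(1)
      by (intro M.finsum_cong') (auto simp: M.m_comm Pi_iff subset_iff simp flip: M.smult_assoc1)
    also have "\<dots> = (\<Oplus>\<^bsub>M\<^esub>a\<in>A. \<zero>\<^bsub>M\<^esub>)"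
      using s A c(1) by (intro M.finsum_cong') (auto simp: Pi_iff)
    finally show ?thesis by simp
  qed
  with s(1) show ?thesis by blast
qed

section \<open>Zero divisors modulo an ideal of a noetherian ring\<close>

lemma (in ideal) add_mem_iff:
  assumes "x \<in> I" "y \<in> carrier R"
  shows "x \<oplus> y \<in> I \<longleftrightarrow> y \<in> I"
proof
  assume "x \<oplus> y \<in> I"
  then have "\<ominus> x \<oplus> (x \<oplus> y) \<in> I"
    by (rule additive_subgroup.a_closed[OF additive_subgroup_axioms
          additive_subgroup.a_inv_closed[OF additive_subgroup_axioms assms(1)]])
  then show "y \<in> I"
    using assms by (simp add: Icarr r_neg1)
qed (use assms additive_subgroup.a_closed[OF additive_subgroup_axioms] in blast)

text \<open>Multiply elements chosen outside \<pp> from \<open>I\<close> and from each member of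
  \<open>Q\<close>; primeness keeps the product outside \<pp>.\<close>

lemma (in cring) ex_common_element_notin_prime:
  assumes "finite Q" "primeideal \<pp> R" "ideal I R" "\<not> I \<subseteq> \<pp>"
    and "\<And>\<qq>. \<qq> \<in> Q \<Longrightarrow> ideal \<qq> R \<and> \<not> \<qq> \<subseteq> \<pp>"
  shows "\<exists>y\<in>I. y \<notin> \<pp> \<and> (\<forall>\<qq>\<in>Q. y \<in> \<qq>)"
  using assms(1,5)
proof (induction Q rule: finite_induct)
  case empty
  then show ?case using assms(4) by blast
next
  case (insert \<qq> Q)
  then obtain y z where yz: "y \<in> I" "y \<notin> \<pp>" "\<forall>\<qq>\<in>Q. y \<in> \<qq>" "z \<in> \<qq>" "z \<notin> \<pp>"
    by (metis insertCI subsetI)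
  interpret \<pp>: primeideal \<pp> R by fact
  interpret I: ideal I R by fact
  interpret \<qq>: ideal \<qq> R using insert.prems by blast
  have R: "y \<in> carrier R" "z \<in> carrier R"
    using yz by auto
  have "y \<otimes> z \<in> \<rr>" if "\<rr> \<in> Q" for \<rr>
    using ideal.I_r_closed[of \<rr> R y z] insert.prems yz R that by blast
  then show ?case
    using yz R \<pp>.I_prime[of y z] I.I_r_closed \<qq>.I_l_closed by (intro bexI[of _ "y \<otimes> z"]) auto
qed

lemma (in cring) prime_avoidance:
  assumes "finite Q" "\<And>\<qq>. \<qq> \<in> Q \<Longrightarrow> primeideal \<qq> R" "ideal I R" "I \<subseteq> \<Union>Q"
  shows "\<exists>\<qq>\<in>Q. I \<subseteq> \<qq>"
  using assms(1,2,4)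
proof (induction "card Q" arbitrary: Q)
  case 0
  then show ?case
    using additive_subgroup.zero_closed[OF ideal.axioms(1)[OF assms(3)]] by auto
next
  case (Suc n)
  then have "Q \<noteq> {}" by auto
  \<comment> \<open>Minimality ensures that no other member of \<open>Q\<close> is contained in
    \<pp>, as the common-element lemma demands.\<close>
  then obtain \<pp> where \<pp>: "\<pp> \<in> Q" "\<And>\<qq>. \<qq> \<in> Q \<Longrightarrow> \<qq> \<subseteq> \<pp> \<Longrightarrow> \<pp> = \<qq>"
    using finite_has_minimal[OF Suc.prems(1)] by metis
  interpret \<pp>: primeideal \<pp> R using \<pp>(1) Suc.prems by blast
  interpret I: ideal I R by fact
  show ?case
  proof (cases "I \<subseteq> \<Union>(Q - {\<pp>}) \<or> I \<subseteq> \<pp>")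
    case True
    moreover have "n = card (Q - {\<pp>})"
      using Suc.hyps(2) Suc.prems(1) \<pp>(1) by simp
    ultimately show ?thesis
      using Suc.hyps(1)[of "Q - {\<pp>}"] Suc.prems \<pp>(1) by blast
  next
    case False
    then obtain x where x: "x \<in> I" "x \<notin> \<Union>(Q - {\<pp>})" by blast
    with Suc.prems(3) have "x \<in> \<pp>" by blast
    \<comment> \<open>Among the members of \<open>Q\<close>, \<open>x\<close> lies in \<pp> alone
      and \<open>y\<close> in all except \<pp>, so \<open>x \<oplus> y\<close> lies in none of them
      although it belongs to \<open>I\<close>.\<close>
    have "\<exists>y\<in>I. y \<notin> \<pp> \<and> (\<forall>\<qq>\<in>Q - {\<pp>}. y \<in> \<qq>)"
    proof (rule ex_common_element_notin_prime)
      show "ideal \<qq> R \<and> \<not> \<qq> \<subseteq> \<pp>" if "\<qq> \<in> Q - {\<pp>}" for \<qq>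
        using that \<pp>(2)[of \<qq>] primeideal.axioms(1)[OF Suc.prems(2)[of \<qq>]] by blast
    qed (use False Suc.prems assms(3) in \<open>auto intro: \<pp>.primeideal\<close>)
    then obtain y where y: "y \<in> I" "y \<notin> \<pp>" "\<And>\<qq>. \<qq> \<in> Q - {\<pp>} \<Longrightarrow> y \<in> \<qq>" by blast
    have "x \<oplus> y \<in> I" using x y by simp
    then obtain \<qq> where \<qq>: "\<qq> \<in> Q" "x \<oplus> y \<in> \<qq>"
      using Suc.prems(3) by blast
    interpret \<qq>: primeideal \<qq> R using \<qq>(1) Suc.prems by blast
    have R: "x \<in> carrier R" "y \<in> carrier R" using x y by auto
    show ?thesis
    proof (cases "\<qq> = \<pp>")
      case True
      then show ?thesis
        using \<qq>(2) \<open>x \<in> \<pp>\<close> \<pp>.add_mem_iff[of x y] R y(2) by simp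
    next
      case False
      then have "y \<in> \<qq>" using y(3) \<qq>(1) by blast
      then have "x \<in> \<qq>"
        using \<qq>(2) \<qq>.add_mem_iff[of y x] R by (simp add: a_comm)
      then show ?thesis using x(2) False \<qq>(1) by blast
    qed
  qed
qed

lemma add_cgenideal_iff:
  "u \<in> J <+>\<^bsub>R\<^esub> PIdl\<^bsub>R\<^esub> y \<longleftrightarrow> (\<exists>j\<in>J. \<exists>c\<in>carrier R. u = j \<oplus>\<^bsub>R\<^esub> c \<otimes>\<^bsub>R\<^esub> y)"
  unfolding set_add_def' cgenideal_def by blast

lemma (in cring) add_cgenideal_supset:
  assumes "ideal J R" "y \<in> carrier R"
  shows "J \<subseteq> J <+>\<^bsub>R\<^esub> PIdl y" and "y \<in> J <+>\<^bsub>R\<^esub> PIdl y"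
proof -
  interpret J: ideal J R by fact
  show "J \<subseteq> J <+>\<^bsub>R\<^esub> PIdl y"
  proof
    fix j assume "j \<in> J"
    moreover from this have "j = j \<oplus> \<zero> \<otimes> y"
      using assms(2) by (simp add: J.Icarr)
    ultimately show "j \<in> J <+>\<^bsub>R\<^esub> PIdl y"
      unfolding add_cgenideal_iff by blast
  qed
  have "y = \<zero> \<oplus> \<one> \<otimes> y"
    using assms(2) by simp
  then show "y \<in> J <+>\<^bsub>R\<^esub> PIdl y"
    unfolding add_cgenideal_iff using additive_subgroup.zero_closed[OF J.additive_subgroup_axioms] by blast
qed

section \<open>Associated primes of R / J over a noetherian ring\<close>

locale noetherian_cring = cring R + noetherian_ring R for R (structure)
begin

text \<open>A nonempty chain of ideals contains its own union here, so Zorn applies to any family of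
  ideals, whether or not it is closed under unions of chains.\<close>

lemma ex_maximal_ideal_in:
  assumes "S \<noteq> {}" "\<And>I. I \<in> S \<Longrightarrow> ideal I R"
  shows "\<exists>I\<in>S. \<forall>J\<in>S. I \<subseteq> J \<longrightarrow> J = I"
proof (rule subset_Zorn_nonempty[OF assms(1)])
  fix C assume C: "C \<noteq> {}" "subset.chain S C"
  then have "subset.chain {I. ideal I R} C"
    using assms(2) by (auto simp: subset_chain_def)
  then have "\<Union>C \<in> C"
    by (rule ideal_chain_is_trivial[OF C(1)])
  moreover have "C \<subseteq> S"
    using C(2) by (simp add: subset_chain_def)
  ultimately show "\<Union>C \<in> S" by (rule rev_subsetD)
qed

text \<open>The annihilator of the class of \<open>y\<close> in R / J; its prime values are the
  associated primes of R / J.\<close>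

definition colon :: "'a set \<Rightarrow> 'a \<Rightarrow> 'a set" where
  "colon J y = {r \<in> carrier R. r \<otimes> y \<in> J}"

lemma colon_ideal:
  assumes "ideal J R" "y \<in> carrier R"
  shows "ideal (colon J y) R"
proof (rule idealI)
  interpret J: ideal J R by fact
  show "subgroup (colon J y) (add_monoid R)"
  proof (rule add.subgroupI)
    have "\<zero> \<in> colon J y" using assms(2) by (simp add: colon_def)
    then show "colon J y \<noteq> {}" by blast
  qed (use assms(2) in \<open>auto simp: colon_def l_distr l_minus\<close>)
  show "x \<otimes> a \<in> colon J y" if "a \<in> colon J y" "x \<in> carrier R" for a x
    using that assms(2) by (auto simp: colon_def m_assoc J.I_l_closed)
  then show "a \<otimes> x \<in> colon J y" if "a \<in> colon J y" "x \<in> carrier R" for a x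
    using that by (auto simp: colon_def m_comm)
qed (rule ring_axioms)

lemma colon_eq_carrier: "ideal J R \<Longrightarrow> y \<in> J \<Longrightarrow> colon J y = carrier R"
  using ideal.I_l_closed by (fastforce simp: colon_def)

text \<open>The class of \<open>y\<close> generates a copy of a domain R / \<qq>, in which all
  nonzero elements have annihilator \<qq>.\<close>

lemma colon_mult:
  assumes "ideal J R" "primeideal (colon J y) R" "y \<in> carrier R" "r \<in> carrier R" "r \<otimes> y \<notin> J"
  shows "colon J (r \<otimes> y) = colon J y"
proof -
  have "a \<otimes> (r \<otimes> y) \<in> J \<longleftrightarrow> a \<otimes> y \<in> J" if a: "a \<in> carrier R" for a
  proof
    assume "a \<otimes> (r \<otimes> y) \<in> J"
    then have "a \<otimes> r \<in> colon J y"
      using a assms(3,4) by (simp add: colon_def m_assoc)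
    moreover have "r \<notin> colon J y"
      using assms(5) by (simp add: colon_def)
    ultimately have "a \<in> colon J y"
      using primeideal.I_prime[OF assms(2) a assms(4)] by blast
    then show "a \<otimes> y \<in> J"
      by (simp add: colon_def)
  next
    assume "a \<otimes> y \<in> J"
    then show "a \<otimes> (r \<otimes> y) \<in> J"
      using ideal.I_l_closed[OF assms(1), of "a \<otimes> y" r] a assms(3,4) by (simp add: m_lcomm)
  qed
  then show ?thesis
    unfolding colon_def by blast
qed

lemma colon_add:
  assumes "ideal J R" "j \<in> J" "v \<in> carrier R"
  shows "colon J (j \<oplus> v) = colon J v"
proof -
  interpret J: ideal J R by fact
  have "a \<otimes> (j \<oplus> v) \<in> J \<longleftrightarrow> a \<otimes> v \<in> J" if "a \<in> carrier R" for a
    using that assms J.add_mem_iff[OF J.I_l_closed[OF assms(2) that], of "a \<otimes> v"]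
    by (simp add: r_distr J.Icarr)
  then show ?thesis
    unfolding colon_def by blast
qed

text \<open>An annihilator that is maximal among those of nonzero classes killed by \<open>r\<close>
  is prime. Hence every zero divisor modulo \<open>J\<close> lies in an associated prime.\<close>

lemma ex_associated_prime:
  assumes J: "ideal J R" and x: "x \<in> carrier R" "x \<notin> J" and r: "r \<in> carrier R" "r \<otimes> x \<in> J"
  shows "\<exists>y\<in>carrier R. primeideal (colon J y) R \<and> r \<in> colon J y"
proof -
  interpret J: ideal J R by fact
  let ?S = "{colon J y | y. y \<in> carrier R \<and> y \<notin> J \<and> r \<in> colon J y}"
  have "colon J x \<in> ?S"
    using x r by (auto simp: colon_def)
  then have "?S \<noteq> {}" by blast
  moreover have "ideal K R" if "K \<in> ?S" for K
    using that colon_ideal[OF J] by auto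
  ultimately have "\<exists>I\<in>?S. \<forall>K\<in>?S. I \<subseteq> K \<longrightarrow> K = I"
    by (rule ex_maximal_ideal_in)
  then obtain I where I: "I \<in> ?S" "\<And>K. K \<in> ?S \<Longrightarrow> I \<subseteq> K \<Longrightarrow> K = I"
    by auto
  then obtain y where y: "y \<in> carrier R" "y \<notin> J" "r \<in> colon J y" "I = colon J y" by blast
  have "primeideal (colon J y) R"
  proof (rule primeidealI[OF colon_ideal[OF J y(1)] is_cring])
    have "\<one> \<notin> colon J y" using y by (simp add: colon_def)
    then show "carrier R \<noteq> colon J y" by blast
    fix a b assume ab: "a \<in> carrier R" "b \<in> carrier R" "a \<otimes> b \<in> colon J y"
    show "a \<in> colon J y \<or> b \<in> colon J y"
    proof (rule disjCI)
      assume "b \<notin> colon J y"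
      then have b: "b \<otimes> y \<notin> J" using ab by (simp add: colon_def)
      have sub: "colon J y \<subseteq> colon J (b \<otimes> y)"
        using ab y(1) J.I_l_closed by (auto simp: colon_def m_lcomm[of _ b])
      then have "colon J (b \<otimes> y) = colon J y"
        using I(2)[of "colon J (b \<otimes> y)"] b ab y by auto
      moreover have "a \<in> colon J (b \<otimes> y)"
        using ab y by (simp add: colon_def m_assoc)
      ultimately show "a \<in> colon J y" by simp
    qed
  qed
  with y show ?thesis by blast
qed

text \<open>Noetherian induction: for \<open>J\<close> maximal with infinitely many associated
  primes, pass to the larger ideal \<open>J + y0 R\<close>, where the class of \<open>y0\<close>
  generates a copy of R / \<qq>. At most one associated prime is lost.\<close>

lemma finite_associated_primes:
  assumes "ideal J R"
  shows "finite {\<qq>. primeideal \<qq> R \<and> (\<exists>y\<in>carrier R. \<qq> = colon J y)}"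
proof (rule ccontr)
  let ?Ass = "\<lambda>J. {\<qq>. primeideal \<qq> R \<and> (\<exists>y\<in>carrier R. \<qq> = colon J y)}"
  let ?S = "{J. ideal J R \<and> infinite (?Ass J)}"
  assume "infinite (?Ass J)"
  with assms have "?S \<noteq> {}" by blast
  then have "\<exists>J\<in>?S. \<forall>K\<in>?S. J \<subseteq> K \<longrightarrow> K = J"
    by (rule ex_maximal_ideal_in) simp
  then obtain J where J: "ideal J R" "infinite (?Ass J)"
    "\<And>K. ideal K R \<Longrightarrow> infinite (?Ass K) \<Longrightarrow> J \<subseteq> K \<Longrightarrow> K = J"
    by auto
  interpret J: ideal J R by fact
  obtain \<qq> z where "primeideal \<qq> R" "z \<in> carrier R" "\<qq> = colon J z"
    using J(2) not_finite_existsD[of "\<lambda>\<qq>. primeideal \<qq> R \<and> (\<exists>y\<in>carrier R. \<qq> = colon J y)"] by blast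
  then obtain y0 where y0: "y0 \<in> carrier R" "primeideal (colon J y0) R" by blast
  let ?J' = "J <+>\<^bsub>R\<^esub> PIdl y0"
  have J': "ideal ?J' R"
    by (intro add_ideals J.is_ideal cgenideal_ideal y0)
  have mem: "u \<in> ?J' \<longleftrightarrow> (\<exists>j\<in>J. \<exists>c\<in>carrier R. u = j \<oplus> c \<otimes> y0)" for u
    by (rule add_cgenideal_iff)
  have sub: "J \<subseteq> ?J'" and "y0 \<in> ?J'"
    using add_cgenideal_supset[OF J.is_ideal y0(1)] by simp_all
  moreover have "y0 \<notin> J"
  proof
    assume "y0 \<in> J"
    then have "colon J y0 = carrier R"
      by (rule colon_eq_carrier[OF J.is_ideal])
    then show False using primeideal.I_notcarr[OF y0(2)] by simp
  qed
  ultimately have fin: "finite (?Ass ?J')"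
    using J(3)[OF J' _ sub] by metis
  have "?Ass J \<subseteq> insert (colon J y0) (?Ass ?J')"
  proof
    fix \<qq> assume "\<qq> \<in> ?Ass J"
    then obtain y where y: "primeideal \<qq> R" "y \<in> carrier R" "\<qq> = colon J y" by blast
    show "\<qq> \<in> insert (colon J y0) (?Ass ?J')"
    \<comment> \<open>Modulo \<open>J\<close>, either the modules generated by \<open>y\<close> and
      \<open>y0\<close> share a nonzero element, and then both annihilators equal that of this
      element, or \<open>y\<close> keeps its annihilator modulo the larger ideal.\<close>
    proof (cases "\<exists>r\<in>carrier R. r \<otimes> y \<in> ?J' \<and> r \<otimes> y \<notin> J")
      case True
      then obtain r j c where r: "r \<in> carrier R" "r \<otimes> y \<notin> J" "j \<in> J" "c \<in> carrier R"
        "r \<otimes> y = j \<oplus> c \<otimes> y0"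
        unfolding mem by blast
      have c: "c \<otimes> y0 \<notin> J"
        using J.add_mem_iff[of j "c \<otimes> y0"] r y0(1) by simp
      have "\<qq> = colon J (r \<otimes> y)"
        using colon_mult[OF J.is_ideal _ y(2) r(1,2)] y(1,3) by simp
      also have "\<dots> = colon J (c \<otimes> y0)"
        unfolding r(5) using r y0(1) by (intro colon_add[OF J.is_ideal]) simp_all
      also have "\<dots> = colon J y0"
        by (rule colon_mult[OF J.is_ideal y0(2,1) r(4) c])
      finally have "\<qq> = colon J y0" .
      then show ?thesis by simp
    next
      case False
      with sub have "colon J y = colon ?J' y"
        unfolding colon_def by blast
      with y show ?thesis by blast
    qed
  qed
  with fin J(2) show False
    using finite_subset by blast
qed

text \<open>Exchanges quantifiers: an ideal of zero divisors lies in the finite union of the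
  associated primes, so in a single one, and the class whose annihilator it is serves for all
  \<open>x\<close>.\<close>

lemma ex_common_zero_divisor:
  assumes J: "ideal J R" and I: "ideal I R"
    and zd: "\<And>x. x \<in> I \<Longrightarrow> \<exists>y\<in>carrier R - J. x \<otimes> y \<in> J"
  shows "\<exists>y\<in>carrier R - J. \<forall>x\<in>I. x \<otimes> y \<in> J"
proof -
  interpret J: ideal J R by fact
  let ?Q = "{\<qq>. primeideal \<qq> R \<and> (\<exists>y\<in>carrier R. \<qq> = colon J y)}"
  have "I \<subseteq> \<Union>?Q"
  proof
    fix x assume x: "x \<in> I"
    then have "x \<in> carrier R" using ideal.Icarr[OF I] by blast
    with zd[OF x] show "x \<in> \<Union>?Q"
      using ex_associated_prime[OF J, of _ x] by blast
  qed
  then obtain \<qq> where "\<qq> \<in> ?Q" "I \<subseteq> \<qq>"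
    using prime_avoidance[of ?Q I] finite_associated_primes[OF J] I by blast
  then obtain y where y: "y \<in> carrier R" "primeideal (colon J y) R" "I \<subseteq> colon J y"
    by blast
  have "y \<notin> J"
  proof
    assume "y \<in> J"
    then have "colon J y = carrier R"
      by (rule colon_eq_carrier[OF J.is_ideal])
    then show False using primeideal.I_notcarr[OF y(2)] by simp
  qed
  with y show ?thesis by (auto simp: colon_def)
qed

end

section \<open>Non-vanishing of Ext on the support\<close>

definition (in module) lin_span :: "'c set \<Rightarrow> 'c set" where
  "lin_span A = {\<Oplus>\<^bsub>M\<^esub>a\<in>A. c a \<odot>\<^bsub>M\<^esub> a | c. c \<in> A \<rightarrow> carrier R}"

lemma (in module) lin_span_empty: "lin_span {} = {\<zero>\<^bsub>M\<^esub>}"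
  by (auto simp: lin_span_def)

lemma (in module) lin_span_insert:
  assumes "finite A" "insert a A \<subseteq> carrier M" "a \<notin> A"
  shows "x \<in> lin_span (insert a A) \<longleftrightarrow> (\<exists>c\<in>carrier R. \<exists>v\<in>lin_span A. x = c \<odot>\<^bsub>M\<^esub> a \<oplus>\<^bsub>M\<^esub> v)"
proof
  assume "x \<in> lin_span (insert a A)"
  then obtain c where c: "c \<in> insert a A \<rightarrow> carrier R" "x = (\<Oplus>\<^bsub>M\<^esub>b\<in>insert a A. c b \<odot>\<^bsub>M\<^esub> b)"
    by (auto simp: lin_span_def)
  then have "x = c a \<odot>\<^bsub>M\<^esub> a \<oplus>\<^bsub>M\<^esub> (\<Oplus>\<^bsub>M\<^esub>b\<in>A. c b \<odot>\<^bsub>M\<^esub> b)"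
    using assms by (auto simp: Pi_iff subset_iff intro!: M.finsum_insert)
  moreover have "(\<Oplus>\<^bsub>M\<^esub>b\<in>A. c b \<odot>\<^bsub>M\<^esub> b) \<in> lin_span A"
    using c(1) by (auto simp: lin_span_def)
  ultimately show "\<exists>c\<in>carrier R. \<exists>v\<in>lin_span A. x = c \<odot>\<^bsub>M\<^esub> a \<oplus>\<^bsub>M\<^esub> v"
    using c(1) by auto
next
  assume "\<exists>c\<in>carrier R. \<exists>v\<in>lin_span A. x = c \<odot>\<^bsub>M\<^esub> a \<oplus>\<^bsub>M\<^esub> v"
  then obtain k c where c: "k \<in> carrier R" "c \<in> A \<rightarrow> carrier R"
    "x = k \<odot>\<^bsub>M\<^esub> a \<oplus>\<^bsub>M\<^esub> (\<Oplus>\<^bsub>M\<^esub>b\<in>A. c b \<odot>\<^bsub>M\<^esub> b)"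
    by (auto simp: lin_span_def)
  let ?c = "c(a := k)"
  have "(\<Oplus>\<^bsub>M\<^esub>b\<in>A. ?c b \<odot>\<^bsub>M\<^esub> b) = (\<Oplus>\<^bsub>M\<^esub>b\<in>A. c b \<odot>\<^bsub>M\<^esub> b)"
    using assms c by (intro M.finsum_cong') (auto simp: Pi_iff subset_iff)
  moreover have "(\<Oplus>\<^bsub>M\<^esub>b\<in>insert a A. ?c b \<odot>\<^bsub>M\<^esub> b) = ?c a \<odot>\<^bsub>M\<^esub> a \<oplus>\<^bsub>M\<^esub> (\<Oplus>\<^bsub>M\<^esub>b\<in>A. ?c b \<odot>\<^bsub>M\<^esub> b)"
    using assms c by (intro M.finsum_insert) (auto simp: Pi_iff subset_iff)
  ultimately have "x = (\<Oplus>\<^bsub>M\<^esub>b\<in>insert a A. ?c b \<odot>\<^bsub>M\<^esub> b)"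
    using c by simp
  moreover have "?c \<in> insert a A \<rightarrow> carrier R"
    using c assms by auto
  ultimately show "x \<in> lin_span (insert a A)"
    unfolding lin_span_def by blast
qed

lemma (in module) lin_span_submodule:
  assumes "finite A" "A \<subseteq> carrier M"
  shows "submodule (lin_span A) R M"
proof (rule submoduleI')
  have sub: "c b \<odot>\<^bsub>M\<^esub> b \<in> carrier M" if "c \<in> A \<rightarrow> carrier R" "b \<in> A" for c b
    using that assms by auto
  show "lin_span A \<subseteq> carrier M"
    using sub by (auto simp: lin_span_def intro!: M.finsum_closed)
  have "(\<Oplus>\<^bsub>M\<^esub>b\<in>A. \<zero> \<odot>\<^bsub>M\<^esub> b) = (\<Oplus>\<^bsub>M\<^esub>b\<in>A. \<zero>\<^bsub>M\<^esub>)"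
    using assms by (intro M.finsum_cong') auto
  then show "\<zero>\<^bsub>M\<^esub> \<in> lin_span A"
    unfolding lin_span_def by (intro CollectI exI[of _ "\<lambda>_. \<zero>"]) auto
  fix x assume "x \<in> lin_span A"
  then obtain c where c: "c \<in> A \<rightarrow> carrier R" "x = (\<Oplus>\<^bsub>M\<^esub>b\<in>A. c b \<odot>\<^bsub>M\<^esub> b)"
    by (auto simp: lin_span_def)
  {
    fix y assume "y \<in> lin_span A"
    then obtain e where e: "e \<in> A \<rightarrow> carrier R" "y = (\<Oplus>\<^bsub>M\<^esub>b\<in>A. e b \<odot>\<^bsub>M\<^esub> b)"
      by (auto simp: lin_span_def)
    have "x \<oplus>\<^bsub>M\<^esub> y = (\<Oplus>\<^bsub>M\<^esub>b\<in>A. c b \<odot>\<^bsub>M\<^esub> b \<oplus>\<^bsub>M\<^esub> e b \<odot>\<^bsub>M\<^esub> b)"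
      unfolding c(2) e(2) using c(1) e(1) sub by (intro M.finsum_addf[symmetric]) auto
    also have "\<dots> = (\<Oplus>\<^bsub>M\<^esub>b\<in>A. (c b \<oplus> e b) \<odot>\<^bsub>M\<^esub> b)"
      using c(1) e(1) assms by (intro M.finsum_cong') (auto simp: smult_l_distr Pi_iff subset_iff)
    finally show "x \<oplus>\<^bsub>M\<^esub> y \<in> lin_span A"
      unfolding lin_span_def using c(1) e(1) by (intro CollectI exI[of _ "\<lambda>b. c b \<oplus> e b"]) auto
  next
    fix a assume a: "a \<in> carrier R"
    have "a \<odot>\<^bsub>M\<^esub> x = (\<Oplus>\<^bsub>M\<^esub>b\<in>A. a \<odot>\<^bsub>M\<^esub> (c b \<odot>\<^bsub>M\<^esub> b))"
      unfolding c(2) using a c(1) sub assms by (intro finsum_smult_ldistr) auto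
    also have "\<dots> = (\<Oplus>\<^bsub>M\<^esub>b\<in>A. (a \<otimes> c b) \<odot>\<^bsub>M\<^esub> b)"
      using a c(1) assms by (intro M.finsum_cong') (auto simp: smult_assoc1 Pi_iff subset_iff)
    finally show "a \<odot>\<^bsub>M\<^esub> x \<in> lin_span A"
      unfolding lin_span_def using c(1) a by (intro CollectI exI[of _ "\<lambda>b. a \<otimes> c b"]) auto
  }
qed

context resolved_module
begin

text \<open>
  A coordinate with respect to a minimal set that generates \<open>M\<close> locally at \<open>\<pp>\<close> gives,
  after clearing denominators, a nonzero homomorphism from \<open>M\<close> to \<open>R / \<pp>\<close>;
  \<open>f\<close> is a lift of it to the free module that covers \<open>M\<close>.
\<close>

lemma ex_hom_to_residue_domain:
  assumes fg: "finitely_generated_module R M" and p: "\<pp> \<in> Supp R M"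
  shows "\<exists>f\<in>module_hom R (F 0) (regular_module R).
    (\<forall>x\<in>carrier (F (Suc 0)). f (d 0 x) \<in> \<pp>) \<and> (\<exists>x\<in>carrier (F 0). f x \<notin> \<pp>)"
proof -
  interpret F: module R "F 0" by (rule free_module_module)
  have "primeideal \<pp> R" using p by (simp add: Supp_def Spec_def)
  then interpret \<pp>: primeideal \<pp> R .
  obtain A where A: "finite A" "A \<subseteq> carrier M"
    "\<And>m. m \<in> carrier M \<Longrightarrow> \<exists>c\<in>A \<rightarrow> carrier R. m = (\<Oplus>\<^bsub>M\<^esub>a\<in>A. c a \<odot>\<^bsub>M\<^esub> a)"
    using fg by (auto simp: finitely_generated_module_def)
  have A_span: "m \<in> lin_span A" if "m \<in> carrier M" for m
    using A(3)[OF that] unfolding lin_span_def by blast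
  \<comment> \<open>Local generation at \<pp> with a single denominator for all of
    \<open>M\<close>.\<close>
  define generates where "generates C \<longleftrightarrow> (\<exists>s\<in>carrier R - \<pp>. \<forall>m\<in>carrier M. s \<odot>\<^bsub>M\<^esub> m \<in> lin_span C)" for C
  let ?S = "{C. C \<subseteq> A \<and> generates C}"
  have "generates A"
    unfolding generates_def using \<pp>.notin_one A_span by (intro bexI[of _ \<one>]) simp_all
  then have "?S \<noteq> {}" by blast
  moreover have "finite ?S" using A(1) by simp
  ultimately obtain C where C: "C \<in> ?S" "\<And>D. D \<in> ?S \<Longrightarrow> D \<subseteq> C \<Longrightarrow> C = D"
    using finite_has_minimal[of ?S] by metis
  then obtain s where s: "s \<in> carrier R - \<pp>" "\<And>m. m \<in> carrier M \<Longrightarrow> s \<odot>\<^bsub>M\<^esub> m \<in> lin_span C"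
    unfolding generates_def by blast
  \<comment> \<open>Otherwise \<open>s\<close> would kill all of \<open>M\<close>, against \<pp>
    being in the support.\<close>
  have "C \<noteq> {}"
  proof
    assume "C = {}"
    with s show False
      using p Supp_iff[OF module_axioms, of \<pp>] by (auto simp: lin_span_empty)
  qed
  then obtain a where a: "a \<in> C" by blast
  define D where "D = C - {a}"
  have D: "finite D" "insert a D \<subseteq> carrier M" "a \<notin> D" "C = insert a D" "a \<in> carrier M" "D \<subseteq> carrier M"
    using C(1) a A finite_subset[of C A] by (auto simp: D_def)
  interpret D: submodule "lin_span D" R M
    using D by (intro lin_span_submodule)
  have not_gen: "\<not> generates D"
    using C(1) C(2)[of D] D(3,4) by blast
  have expand: "\<exists>c\<in>carrier R. \<exists>w\<in>lin_span D. s \<odot>\<^bsub>M\<^esub> m = c \<odot>\<^bsub>M\<^esub> a \<oplus>\<^bsub>M\<^esub> w" if "m \<in> carrier M" for m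
    using s(2)[OF that] lin_span_insert[OF D(1-3)] by (simp add: D(4))
  have spanD: "lin_span D \<subseteq> carrier M" "\<zero>\<^bsub>M\<^esub> \<in> lin_span D"
    using D.subset D.one_closed by simp_all
  note span_add = submoduleE(5)[OF D.submodule_axioms]
  note span_minus = submoduleE(3)[OF D.submodule_axioms]
  \<comment> \<open>Minimality of \<open>C\<close> enters here: if \<open>v\<close> were outside
    \<pp>, then \<open>D\<close> would already generate locally, with denominator
    \<open>v \<otimes> s\<close>.\<close>
  have in_p: "v \<in> \<pp>" if v: "v \<in> carrier R" "v \<odot>\<^bsub>M\<^esub> a \<in> lin_span D" for v
  proof (rule ccontr)
    assume "v \<notin> \<pp>"
    with v have "v \<in> carrier R - \<pp>" by blast
    then have vs: "v \<otimes> s \<in> carrier R - \<pp>"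
      using \<pp>.notin_mult s(1) by blast
    have "(v \<otimes> s) \<odot>\<^bsub>M\<^esub> m \<in> lin_span D" if m: "m \<in> carrier M" for m
    proof -
      obtain c w where c: "c \<in> carrier R" "w \<in> lin_span D" "s \<odot>\<^bsub>M\<^esub> m = c \<odot>\<^bsub>M\<^esub> a \<oplus>\<^bsub>M\<^esub> w"
        using expand[OF m] by blast
      have w: "w \<in> carrier M" using c(2) spanD by blast
      have "(v \<otimes> s) \<odot>\<^bsub>M\<^esub> m = v \<odot>\<^bsub>M\<^esub> (c \<odot>\<^bsub>M\<^esub> a \<oplus>\<^bsub>M\<^esub> w)"
        using v s(1) m by (simp add: smult_assoc1 c(3))
      also have "\<dots> = (v \<otimes> c) \<odot>\<^bsub>M\<^esub> a \<oplus>\<^bsub>M\<^esub> v \<odot>\<^bsub>M\<^esub> w"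
        using v c(1) w D by (simp add: smult_r_distr smult_assoc1)
      also have "(v \<otimes> c) \<odot>\<^bsub>M\<^esub> a = c \<odot>\<^bsub>M\<^esub> (v \<odot>\<^bsub>M\<^esub> a)"
        using v c(1) D(5) by (simp add: m_comm flip: smult_assoc1)
      finally show ?thesis
        using span_add v c(1,2) by simp
    qed
    with vs not_gen show False
      unfolding generates_def by blast
  qed
  \<comment> \<open>The coefficient of \<open>a\<close> in \<open>s \<epsilon> x\<close> is not
    unique in \<open>R\<close>, only modulo \<pp> by \<open>in_p\<close>. Freeness still allows it
    to be chosen linearly in \<open>x\<close>.\<close>
  have "\<exists>f\<in>module_hom R (F 0) (regular_module R). \<forall>x\<in>carrier (F 0).
      \<exists>w\<in>lin_span D. s \<odot>\<^bsub>M\<^esub> \<epsilon> x = f x \<odot>\<^bsub>M\<^esub> a \<oplus>\<^bsub>M\<^esub> w"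
  proof (rule free_module_hom_of_relation[OF regular_module_module])
    show "\<exists>v\<in>carrier (regular_module R). \<exists>w\<in>lin_span D.
        s \<odot>\<^bsub>M\<^esub> \<epsilon> (unit_vector R b) = v \<odot>\<^bsub>M\<^esub> a \<oplus>\<^bsub>M\<^esub> w" if "b \<in> B 0" for b
      using expand[OF augmentation_closed[OF unit_vector_closed[OF that]]] by simp
    show "\<exists>w\<in>lin_span D. s \<odot>\<^bsub>M\<^esub> \<epsilon> \<zero>\<^bsub>F 0\<^esub> = \<zero>\<^bsub>regular_module R\<^esub> \<odot>\<^bsub>M\<^esub> a \<oplus>\<^bsub>M\<^esub> w"
      using s(1) spanD D(5) module_hom_zero[OF F.module_axioms module_axioms augmentation_hom]
      by (intro bexI[of _ "\<zero>\<^bsub>M\<^esub>"]) auto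
  next
    fix x y u v
    assume *: "x \<in> carrier (F 0)" "y \<in> carrier (F 0)" "u \<in> carrier (regular_module R)"
      "v \<in> carrier (regular_module R)"
      "\<exists>w\<in>lin_span D. s \<odot>\<^bsub>M\<^esub> \<epsilon> x = u \<odot>\<^bsub>M\<^esub> a \<oplus>\<^bsub>M\<^esub> w"
      "\<exists>w\<in>lin_span D. s \<odot>\<^bsub>M\<^esub> \<epsilon> y = v \<odot>\<^bsub>M\<^esub> a \<oplus>\<^bsub>M\<^esub> w"
    then obtain w w' where w: "w \<in> lin_span D" "s \<odot>\<^bsub>M\<^esub> \<epsilon> x = u \<odot>\<^bsub>M\<^esub> a \<oplus>\<^bsub>M\<^esub> w"
      "w' \<in> lin_span D" "s \<odot>\<^bsub>M\<^esub> \<epsilon> y = v \<odot>\<^bsub>M\<^esub> a \<oplus>\<^bsub>M\<^esub> w'"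
      by blast
    have cl: "w \<in> carrier M" "w' \<in> carrier M" using w spanD by auto
    have "s \<odot>\<^bsub>M\<^esub> \<epsilon> (x \<oplus>\<^bsub>F 0\<^esub> y) = s \<odot>\<^bsub>M\<^esub> \<epsilon> x \<oplus>\<^bsub>M\<^esub> s \<odot>\<^bsub>M\<^esub> \<epsilon> y"
      using * s(1) by (simp add: module_hom_add[OF augmentation_hom] augmentation_closed smult_r_distr)
    also have "\<dots> = (u \<oplus> v) \<odot>\<^bsub>M\<^esub> a \<oplus>\<^bsub>M\<^esub> (w \<oplus>\<^bsub>M\<^esub> w')"
      unfolding w(2,4) using *(3,4) D(5) cl by (simp add: smult_l_distr M.a_ac)
    finally show "\<exists>w\<in>lin_span D. s \<odot>\<^bsub>M\<^esub> \<epsilon> (x \<oplus>\<^bsub>F 0\<^esub> y) = (u \<oplus>\<^bsub>regular_module R\<^esub> v) \<odot>\<^bsub>M\<^esub> a \<oplus>\<^bsub>M\<^esub> w"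
      using span_add[OF w(1,3)] by auto
  next
    fix k x u
    assume *: "k \<in> carrier R" "x \<in> carrier (F 0)" "u \<in> carrier (regular_module R)"
      "\<exists>w\<in>lin_span D. s \<odot>\<^bsub>M\<^esub> \<epsilon> x = u \<odot>\<^bsub>M\<^esub> a \<oplus>\<^bsub>M\<^esub> w"
    then obtain w where w: "w \<in> lin_span D" "s \<odot>\<^bsub>M\<^esub> \<epsilon> x = u \<odot>\<^bsub>M\<^esub> a \<oplus>\<^bsub>M\<^esub> w"
      by blast
    have cl: "w \<in> carrier M" using w spanD by auto
    have "s \<odot>\<^bsub>M\<^esub> \<epsilon> (k \<odot>\<^bsub>F 0\<^esub> x) = (s \<otimes> k) \<odot>\<^bsub>M\<^esub> \<epsilon> x"
      using * s(1) by (simp add: module_hom_smult[OF augmentation_hom] augmentation_closed smult_assoc1)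
    also have "\<dots> = k \<odot>\<^bsub>M\<^esub> (s \<odot>\<^bsub>M\<^esub> \<epsilon> x)"
      using * s(1) by (simp add: m_comm augmentation_closed flip: smult_assoc1)
    also have "\<dots> = (k \<otimes> u) \<odot>\<^bsub>M\<^esub> a \<oplus>\<^bsub>M\<^esub> k \<odot>\<^bsub>M\<^esub> w"
      unfolding w(2) using *(1,3) D(5) cl by (simp add: smult_r_distr smult_assoc1)
    finally show "\<exists>w\<in>lin_span D. s \<odot>\<^bsub>M\<^esub> \<epsilon> (k \<odot>\<^bsub>F 0\<^esub> x) = (k \<odot>\<^bsub>regular_module R\<^esub> u) \<odot>\<^bsub>M\<^esub> a \<oplus>\<^bsub>M\<^esub> w"
      using D.smult_closed[OF *(1) w(1)] by auto
  qed
  then obtain f where f: "f \<in> module_hom R (F 0) (regular_module R)"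
    "\<And>x. x \<in> carrier (F 0) \<Longrightarrow> \<exists>w\<in>lin_span D. s \<odot>\<^bsub>M\<^esub> \<epsilon> x = f x \<odot>\<^bsub>M\<^esub> a \<oplus>\<^bsub>M\<^esub> w"
    by blast
  have f_closed: "f x \<in> carrier R" if "x \<in> carrier (F 0)" for x
    using module_hom_closed[OF f(1) that] by simp
  have "f (d 0 x) \<in> \<pp>" if x: "x \<in> carrier (F (Suc 0))" for x
  proof -
    obtain w where w: "w \<in> lin_span D" "s \<odot>\<^bsub>M\<^esub> \<epsilon> (d 0 x) = f (d 0 x) \<odot>\<^bsub>M\<^esub> a \<oplus>\<^bsub>M\<^esub> w"
      using f(2) x d_closed by blast
    then have "f (d 0 x) \<odot>\<^bsub>M\<^esub> a = \<ominus>\<^bsub>M\<^esub> w"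
      using x s(1) spanD D(5) f_closed[OF d_closed[OF x]]
      by (intro M.minus_equality[symmetric]) (auto simp: augmentation_d M.a_comm)
    then show ?thesis
      using in_p[of "f (d 0 x)"] f_closed[OF d_closed[OF x]] span_minus[OF w(1)] by simp
  qed
  moreover obtain x where x: "x \<in> carrier (F 0)" "\<epsilon> x = a"
    using augmentation_surj D(5) by (metis imageE)
  \<comment> \<open>For \<open>x\<close> above \<open>a\<close>, the coefficient is congruent to
    \<open>s\<close> modulo \<pp>.\<close>
  have "f x \<notin> \<pp>"
  proof
    assume fx: "f x \<in> \<pp>"
    obtain w where w: "w \<in> lin_span D" "s \<odot>\<^bsub>M\<^esub> a = f x \<odot>\<^bsub>M\<^esub> a \<oplus>\<^bsub>M\<^esub> w"
      using f(2)[OF x(1)] x(2) by blast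
    then have "(s \<ominus> f x) \<odot>\<^bsub>M\<^esub> a = w"
      using s(1) f_closed[OF x(1)] D(5) spanD
      by (simp add: a_minus_def smult_l_distr smult_l_minus M.a_ac subset_iff M.r_neg M.r_neg1 M.r_neg2)
    with w(1) have "s \<ominus> f x \<in> \<pp>"
      using in_p[of "s \<ominus> f x"] s(1) f_closed[OF x(1)] by simp
    then have "f x \<oplus> (s \<ominus> f x) \<in> \<pp>"
      using \<pp>.add_mem_iff[OF fx] s(1) f_closed[OF x(1)] by simp
    moreover have "f x \<oplus> (s \<ominus> f x) = s"
      using s(1) f_closed[OF x(1)] by (simp add: a_minus_def R.a_lcomm R.r_neg)
    ultimately show False
      using s(1) by simp
  qed
  ultimately show ?thesis
    using f(1) x(1) by blast
qed

end

section \<open>Acyclicity of the dual complex modulo an ideal, locally at a prime\<close>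

context resolved_module
begin

text \<open>
  The cohomology of \<open>Hom (F\<^sub>\<bullet>, R / J)\<close> vanishes locally at \<open>\<pp>\<close>; since the \<open>F\<^sub>i\<close> are free,
  its cochains are represented by homomorphisms into \<open>R\<close>.
\<close>

definition locally_acyclic :: "'r set \<Rightarrow> 'r set \<Rightarrow> bool" where
  "locally_acyclic \<pp> J \<longleftrightarrow>
     (\<forall>i. \<forall>f\<in>module_hom R (F i) (regular_module R). (\<forall>x\<in>carrier (F (Suc i)). f (d i x) \<in> J) \<longrightarrow>
       (\<exists>s\<in>carrier R - \<pp>. \<exists>c\<in>Hom_coboundaries R B d (regular_module R) i.
          \<forall>x\<in>carrier (F i). s \<otimes> f x \<ominus> c x \<in> J))"

lemma locally_acyclicD:
  assumes "locally_acyclic \<pp> J" "f \<in> module_hom R (F i) (regular_module R)"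
    and "\<And>x. x \<in> carrier (F (Suc i)) \<Longrightarrow> f (d i x) \<in> J"
  obtains s c where "s \<in> carrier R - \<pp>" "c \<in> Hom_coboundaries R B d (regular_module R) i"
    "\<And>x. x \<in> carrier (F i) \<Longrightarrow> s \<otimes> f x \<ominus> c x \<in> J"
proof -
  have "\<forall>x\<in>carrier (F (Suc i)). f (d i x) \<in> J"
    using assms(3) by (rule ballI)
  then have "\<exists>s\<in>carrier R - \<pp>. \<exists>c\<in>Hom_coboundaries R B d (regular_module R) i.
      \<forall>x\<in>carrier (F i). s \<otimes> f x \<ominus> c x \<in> J"
    by (rule assms(1)[unfolded locally_acyclic_def, THEN spec, THEN bspec, OF assms(2), THEN mp])
  then show ?thesis
    using that by auto
qed

lemma regular_hom_closed:
  "f \<in> module_hom R (F i) (regular_module R) \<Longrightarrow> x \<in> carrier (F i) \<Longrightarrow> f x \<in> carrier R"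
  using module_hom_closed by fastforce

lemma coboundary_closed:
  assumes "c \<in> Hom_coboundaries R B d (regular_module R) i" "x \<in> carrier (F i)"
  shows "c x \<in> carrier R"
  using coboundary_in_cocycles[OF regular_module_module assms(1)] assms(2)
  by (auto simp: Hom_cocycles_iff intro: regular_hom_closed)

text \<open>A single closure fact: plain multiples are the case where one coefficient is zero, and
  the general case is the correction term in the long exact sequence.\<close>

lemma regular_hom_combine:
  assumes "f \<in> module_hom R (F i) (regular_module R)" "g \<in> module_hom R (F i) (regular_module R)"
    and "a \<in> carrier R" "b \<in> carrier R"
  shows "(\<lambda>x\<in>carrier (F i). a \<otimes> f x \<ominus> b \<otimes> g x) \<in> module_hom R (F i) (regular_module R)"
proof -
  interpret F: module R "F i" by (rule free_module_module)
  note closed = assms(1,2)[THEN regular_hom_closed]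
  have lin: "a \<otimes> (u \<oplus> u') \<ominus> b \<otimes> (v \<oplus> v') = (a \<otimes> u \<ominus> b \<otimes> v) \<oplus> (a \<otimes> u' \<ominus> b \<otimes> v')"
    if "u \<in> carrier R" "u' \<in> carrier R" "v \<in> carrier R" "v' \<in> carrier R" for u u' v v'
    using that assms(3,4) by (simp add: a_minus_def r_distr R.minus_add R.a_ac)
  have scal: "a \<otimes> (k \<otimes> u) \<ominus> b \<otimes> (k \<otimes> v) = k \<otimes> (a \<otimes> u \<ominus> b \<otimes> v)"
    if "k \<in> carrier R" "u \<in> carrier R" "v \<in> carrier R" for k u v
    using that assms(3,4) by (simp add: a_minus_def r_distr r_minus m_lcomm)
  show ?thesis
  proof (rule module_homI)
    show "(\<lambda>x\<in>carrier (F i). a \<otimes> f x \<ominus> b \<otimes> g x) \<in> carrier (F i) \<rightarrow>\<^sub>E carrier (regular_module R)"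
      using assms(3,4) closed by auto
  qed (use assms closed lin scal in \<open>simp_all add: module_hom_add module_hom_smult\<close>)
qed

text \<open>The class of \<open>y\<close> in R / J already vanishes locally at \<pp>. Multiplication
  by \<open>s\<close> turns a cocycle modulo \<open>J + y R\<close> into one modulo
  \<open>J\<close>, and \<open>s\<close> is absorbed into the denominator.\<close>

lemma locally_acyclic_saturate:
  assumes J: "ideal J R" and acyclic: "locally_acyclic \<pp> J" and "primeideal \<pp> R"
    and s: "s \<in> carrier R - \<pp>" and y: "y \<in> carrier R" "s \<otimes> y \<in> J"
  shows "locally_acyclic \<pp> (J <+>\<^bsub>R\<^esub> PIdl y)"
  unfolding locally_acyclic_def
proof (intro allI ballI impI)
  interpret \<pp>: primeideal \<pp> R by fact
  fix i f assume f: "f \<in> module_hom R (F i) (regular_module R)"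
    and f_d: "\<forall>x\<in>carrier (F (Suc i)). f (d i x) \<in> J <+>\<^bsub>R\<^esub> PIdl y"
  \<comment> \<open>This is \<open>s f\<close>; the zero term fits it to
    \<open>regular_hom_combine\<close>.\<close>
  let ?g = "\<lambda>x\<in>carrier (F i). s \<otimes> f x \<ominus> \<zero> \<otimes> f x"
  have g: "?g x = s \<otimes> f x" if "x \<in> carrier (F i)" for x
    using that s regular_hom_closed[OF f that] by (simp add: a_minus_def)
  have g_hom: "?g \<in> module_hom R (F i) (regular_module R)"
    using s f by (intro regular_hom_combine) auto
  have "?g (d i x) \<in> J" if x: "x \<in> carrier (F (Suc i))" for x
  proof -
    obtain j c where jc: "j \<in> J" "c \<in> carrier R" "f (d i x) = j \<oplus> c \<otimes> y"
      using f_d x unfolding add_cgenideal_iff by blast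
    have j: "j \<in> carrier R" using ideal.Icarr[OF J jc(1)] .
    have "s \<otimes> f (d i x) = s \<otimes> j \<oplus> c \<otimes> (s \<otimes> y)"
      using s y j jc(2) by (simp add: jc(3) r_distr m_lcomm)
    moreover have "s \<otimes> j \<in> J" "c \<otimes> (s \<otimes> y) \<in> J"
      using ideal.I_l_closed[OF J] s y jc by auto
    ultimately have "s \<otimes> f (d i x) \<in> J"
      using additive_subgroup.a_closed[OF ideal.axioms(1)[OF J]] by metis
    then show ?thesis
      using g[OF d_closed[OF x]] by simp
  qed
  from locally_acyclicD[OF acyclic g_hom this] obtain t c
    where t: "t \<in> carrier R - \<pp>" "c \<in> Hom_coboundaries R B d (regular_module R) i"
      "\<And>x. x \<in> carrier (F i) \<Longrightarrow> t \<otimes> ?g x \<ominus> c x \<in> J"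
    by blast
  have "(t \<otimes> s) \<otimes> f x \<ominus> c x \<in> J <+>\<^bsub>R\<^esub> PIdl y" if x: "x \<in> carrier (F i)" for x
  proof -
    have "(t \<otimes> s) \<otimes> f x \<ominus> c x = t \<otimes> ?g x \<ominus> c x"
      using t(1) s regular_hom_closed[OF f x] unfolding g[OF x] by (simp add: m_assoc)
    then show ?thesis
      using t(3)[OF x] add_cgenideal_supset(1)[OF J y(1)] by auto
  qed
  moreover have "t \<otimes> s \<in> carrier R - \<pp>"
    using \<pp>.notin_mult t(1) s by blast
  ultimately show "\<exists>s\<in>carrier R - \<pp>. \<exists>c\<in>Hom_coboundaries R B d (regular_module R) i.
      \<forall>x\<in>carrier (F i). s \<otimes> f x \<ominus> c x \<in> J <+>\<^bsub>R\<^esub> PIdl y"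
    using t(2) by blast
qed

text \<open>
  An element-wise version of the long exact sequence of
  \<open>0 \<rightarrow> R / J \<rightarrow> R / J \<rightarrow> R / (J + x R) \<rightarrow> 0\<close>, where the first map is multiplication by \<open>x\<close>.
\<close>

lemma locally_acyclic_add_nonzerodivisor:
  assumes J: "ideal J R" and acyclic: "locally_acyclic \<pp> J" and "primeideal \<pp> R"
    and x: "x \<in> carrier R" and nzd: "\<And>y. y \<in> carrier R \<Longrightarrow> x \<otimes> y \<in> J \<Longrightarrow> y \<in> J"
  shows "locally_acyclic \<pp> (J <+>\<^bsub>R\<^esub> PIdl x)"
  unfolding locally_acyclic_def
proof (intro allI ballI impI)
  interpret \<pp>: primeideal \<pp> R by fact
  note J_add = additive_subgroup.a_closed[OF ideal.axioms(1)[OF J]]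
  note J_l = ideal.I_l_closed[OF J]
  note d0 = module_hom_zero[OF free_module_module free_module_module d_hom]
  fix i f assume f: "f \<in> module_hom R (F i) (regular_module R)"
    and f_d: "\<forall>z\<in>carrier (F (Suc i)). f (d i z) \<in> J <+>\<^bsub>R\<^esub> PIdl x"
  note f_closed = regular_hom_closed[OF f]
  have f0: "f \<zero>\<^bsub>F i\<^esub> = \<zero>"
    using module_hom_zero[OF free_module_module regular_module_module f] by simp
  have zero: "\<zero> \<in> J"
    using additive_subgroup.zero_closed[OF ideal.axioms(1)[OF J]] .
  \<comment> \<open>The connecting homomorphism: the coboundary of \<open>f\<close> is divisible by
    \<open>x\<close> modulo \<open>J\<close>, and \<open>k\<close> is the quotient, a cochain one
    degree higher.\<close>
  have "\<exists>k\<in>module_hom R (F (Suc i)) (regular_module R).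
      \<forall>z\<in>carrier (F (Suc i)). f (d i z) \<ominus> x \<otimes> k z \<in> J"
  proof (rule free_module_hom_of_relation[OF regular_module_module])
    fix b assume "b \<in> B (Suc i)"
    then have "f (d i (unit_vector R b)) \<in> J <+>\<^bsub>R\<^esub> PIdl x"
      by (rule bspec[OF f_d unit_vector_closed])
    then obtain j c where jc: "j \<in> J" "c \<in> carrier R" "f (d i (unit_vector R b)) = j \<oplus> c \<otimes> x"
      unfolding add_cgenideal_iff by blast
    have "f (d i (unit_vector R b)) \<ominus> x \<otimes> c = j"
      using x jc(2) ideal.Icarr[OF J jc(1)] by (simp add: jc(3) m_comm a_minus_def R.a_assoc R.r_neg)
    with jc(1,2) show "\<exists>v\<in>carrier (regular_module R). f (d i (unit_vector R b)) \<ominus> x \<otimes> v \<in> J"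
      by (intro bexI[of _ c]) simp_all
  next
    show "f (d i \<zero>\<^bsub>F (Suc i)\<^esub>) \<ominus> x \<otimes> \<zero>\<^bsub>regular_module R\<^esub> \<in> J"
      using x zero by (simp add: d0 f0 a_minus_def)
  next
    fix z w u v assume *: "z \<in> carrier (F (Suc i))" "w \<in> carrier (F (Suc i))"
      "u \<in> carrier (regular_module R)" "v \<in> carrier (regular_module R)"
      "f (d i z) \<ominus> x \<otimes> u \<in> J" "f (d i w) \<ominus> x \<otimes> v \<in> J"
    have "f (d i (z \<oplus>\<^bsub>F (Suc i)\<^esub> w)) \<ominus> x \<otimes> (u \<oplus>\<^bsub>regular_module R\<^esub> v) =
        (f (d i z) \<ominus> x \<otimes> u) \<oplus> (f (d i w) \<ominus> x \<otimes> v)"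
      using *(1-4) x by (simp add: module_hom_add[OF d_hom] module_hom_add[OF f] d_closed f_closed
          a_minus_def r_distr R.minus_add R.a_ac)
    then show "f (d i (z \<oplus>\<^bsub>F (Suc i)\<^esub> w)) \<ominus> x \<otimes> (u \<oplus>\<^bsub>regular_module R\<^esub> v) \<in> J"
      using J_add[OF *(5,6)] by simp
  next
    fix a z u assume *: "a \<in> carrier R" "z \<in> carrier (F (Suc i))" "u \<in> carrier (regular_module R)"
      "f (d i z) \<ominus> x \<otimes> u \<in> J"
    have "f (d i (a \<odot>\<^bsub>F (Suc i)\<^esub> z)) \<ominus> x \<otimes> (a \<odot>\<^bsub>regular_module R\<^esub> u) =
        a \<otimes> (f (d i z) \<ominus> x \<otimes> u)"
      using *(1-3) x by (simp add: module_hom_smult[OF d_hom] module_hom_smult[OF f] d_closed f_closed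
          a_minus_def r_distr r_minus m_lcomm)
    then show "f (d i (a \<odot>\<^bsub>F (Suc i)\<^esub> z)) \<ominus> x \<otimes> (a \<odot>\<^bsub>regular_module R\<^esub> u) \<in> J"
      using J_l[OF *(4,1)] by simp
  qed
  then obtain k where k: "k \<in> module_hom R (F (Suc i)) (regular_module R)"
    "\<And>z. z \<in> carrier (F (Suc i)) \<Longrightarrow> f (d i z) \<ominus> x \<otimes> k z \<in> J"
    by blast
  note k_closed = regular_hom_closed[OF k(1)]
  \<comment> \<open>Here \<open>x k\<close> agrees modulo \<open>J\<close> with the coboundary of
    \<open>f\<close>, which vanishes on boundaries; \<open>x\<close> cancels as a nonzerodivisor
    modulo \<open>J\<close>.\<close>
  have "k (d (Suc i) w) \<in> J" if w: "w \<in> carrier (F (Suc (Suc i)))" for w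
  proof -
    let ?v = "k (d (Suc i) w)"
    have v: "?v \<in> carrier R" using k_closed d_closed[OF w] .
    have "\<zero> \<ominus> x \<otimes> ?v \<in> J"
      using k(2)[OF d_closed[OF w]] by (simp add: d_d[OF w] f0)
    then have "\<ominus> (\<ominus> (x \<otimes> ?v)) \<in> J"
      using v x by (subst additive_subgroup.a_inv_closed[OF ideal.axioms(1)[OF J]]) (simp_all add: a_minus_def)
    then show ?thesis
      using nzd[OF v] v x by simp
  qed
  from locally_acyclicD[OF acyclic k(1) this] obtain s c where s: "s \<in> carrier R - \<pp>"
    "c \<in> Hom_coboundaries R B d (regular_module R) (Suc i)"
    "\<And>z. z \<in> carrier (F (Suc i)) \<Longrightarrow> s \<otimes> k z \<ominus> c z \<in> J"
    by blast
  then obtain h where h: "h \<in> module_hom R (F i) (regular_module R)"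
    "c = compose (carrier (F (Suc i))) h (d i)"
    by (auto simp: Hom_coboundaries_Suc)
  note h_closed = regular_hom_closed[OF h(1)]
  \<comment> \<open>Acyclicity in degree \<open>Suc i\<close> gave \<open>s k\<close> as the
    coboundary of \<open>h\<close> modulo \<open>J\<close>. Subtracting \<open>x h\<close> makes
    \<open>s f\<close> a cocycle modulo \<open>J\<close> without changing it modulo
    \<open>x\<close>.\<close>
  let ?g = "\<lambda>z\<in>carrier (F i). s \<otimes> f z \<ominus> x \<otimes> h z"
  have g_hom: "?g \<in> module_hom R (F i) (regular_module R)"
    using s x f h(1) by (intro regular_hom_combine) auto
  have "?g (d i z) \<in> J" if z: "z \<in> carrier (F (Suc i))" for z
  proof -
    have cl: "f (d i z) \<in> carrier R" "k z \<in> carrier R" "h (d i z) \<in> carrier R" "s \<in> carrier R"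
      using f_closed k_closed h_closed d_closed z s by auto
    have "s \<otimes> f (d i z) \<ominus> x \<otimes> h (d i z) =
        s \<otimes> (f (d i z) \<ominus> x \<otimes> k z) \<oplus> x \<otimes> (s \<otimes> k z \<ominus> h (d i z))"
    proof -
      have "s \<otimes> (f (d i z) \<ominus> x \<otimes> k z) = s \<otimes> f (d i z) \<ominus> x \<otimes> (s \<otimes> k z)"
        "x \<otimes> (s \<otimes> k z \<ominus> h (d i z)) = x \<otimes> (s \<otimes> k z) \<ominus> x \<otimes> h (d i z)"
        using cl x by (simp_all add: a_minus_def r_distr r_minus m_lcomm)
      then show ?thesis
        using cl x by (simp add: a_minus_def R.a_assoc R.r_neg1)
    qed
    moreover have "s \<otimes> (f (d i z) \<ominus> x \<otimes> k z) \<in> J"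
      using J_l k(2)[OF z] cl by blast
    moreover have "x \<otimes> (s \<otimes> k z \<ominus> h (d i z)) \<in> J"
      using J_l s(3)[OF z] x z by (simp add: h(2) compose_eq)
    ultimately show ?thesis
      using J_add d_closed[OF z] by simp
  qed
  from locally_acyclicD[OF acyclic g_hom this] obtain t e where t: "t \<in> carrier R - \<pp>"
    "e \<in> Hom_coboundaries R B d (regular_module R) i"
    "\<And>z. z \<in> carrier (F i) \<Longrightarrow> t \<otimes> ?g z \<ominus> e z \<in> J"
    by blast
  \<comment> \<open>The correction \<open>t h\<close> times \<open>x\<close> disappears in the
    enlarged ideal, and the two denominators multiply.\<close>
  have "(t \<otimes> s) \<otimes> f z \<ominus> e z \<in> J <+>\<^bsub>R\<^esub> PIdl x" if z: "z \<in> carrier (F i)" for z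
  proof -
    have cl: "f z \<in> carrier R" "h z \<in> carrier R" "e z \<in> carrier R" "s \<in> carrier R" "t \<in> carrier R"
      using f_closed h_closed z s t coboundary_closed[OF t(2)] by auto
    have "t \<otimes> ?g z = (t \<otimes> s) \<otimes> f z \<ominus> (t \<otimes> h z) \<otimes> x"
      using cl x z by (simp add: a_minus_def r_distr r_minus m_ac)
    then have "(t \<otimes> s) \<otimes> f z \<ominus> e z = (t \<otimes> ?g z \<ominus> e z) \<oplus> (t \<otimes> h z) \<otimes> x"
      using cl x by (simp add: a_minus_def R.a_ac R.r_neg R.r_neg1 R.r_neg2)
    then show ?thesis
      unfolding add_cgenideal_iff using t(3)[OF z] cl by blast
  qed
  moreover have "t \<otimes> s \<in> carrier R - \<pp>"
    using \<pp>.notin_mult t(1) s(1) by blast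
  ultimately show "\<exists>s\<in>carrier R - \<pp>. \<exists>c\<in>Hom_coboundaries R B d (regular_module R) i.
      \<forall>z\<in>carrier (F i). s \<otimes> f z \<ominus> c z \<in> J <+>\<^bsub>R\<^esub> PIdl x"
    using t(2) by blast
qed

text \<open>The ideals are kept inside \<pp>, so that \<open>\<one>\<close> stays out of
  \<open>J\<close>; without this bound the unit ideal would be a maximal choice and give no
  contradiction.\<close>

lemma not_locally_acyclic:
  assumes "noetherian_ring R" "finitely_generated_module R M" "\<pp> \<in> Supp R M"
  shows "\<not> locally_acyclic \<pp> {\<zero>}"
proof
  assume acyclic: "locally_acyclic \<pp> {\<zero>}"
  interpret noetherian_cring R
    using assms(1) is_cring by (rule noetherian_cring.intro[rotated])
  have \<pp>: "primeideal \<pp> R" using assms(3) by (simp add: Supp_def Spec_def)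
  interpret \<pp>: primeideal \<pp> R by (rule \<pp>)
  let ?S = "{J. ideal J R \<and> J \<subseteq> \<pp> \<and> locally_acyclic \<pp> J}"
  have "{\<zero>} \<in> ?S"
    using acyclic zeroideal additive_subgroup.zero_closed[OF \<pp>.additive_subgroup_axioms] by simp
  then have "?S \<noteq> {}" by blast
  then have "\<exists>J\<in>?S. \<forall>K\<in>?S. J \<subseteq> K \<longrightarrow> K = J"
    by (rule ex_maximal_ideal_in) simp
  then obtain J where J: "ideal J R" "J \<subseteq> \<pp>" "locally_acyclic \<pp> J"
    "\<And>K. ideal K R \<Longrightarrow> K \<subseteq> \<pp> \<Longrightarrow> locally_acyclic \<pp> K \<Longrightarrow> J \<subseteq> K \<Longrightarrow> K = J"
    by auto
  \<comment> \<open>Maximality restated as a closure property of \<open>J\<close> with respect to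
    elements of \<pp>.\<close>
  have absorb: "y \<in> J" if y: "y \<in> \<pp>" "locally_acyclic \<pp> (J <+>\<^bsub>R\<^esub> PIdl y)" for y
  proof -
    have R: "y \<in> carrier R" using \<pp>.Icarr[OF y(1)] .
    have "J <+>\<^bsub>R\<^esub> PIdl y \<subseteq> \<pp>"
    proof
      fix u assume "u \<in> J <+>\<^bsub>R\<^esub> PIdl y"
      then obtain j c where "j \<in> J" "c \<in> carrier R" "u = j \<oplus> c \<otimes> y"
        unfolding add_cgenideal_iff by blast
      with y(1) J(2) show "u \<in> \<pp>"
        using \<pp>.add_mem_iff[of j "c \<otimes> y"] \<pp>.I_l_closed[of y c] R by auto
    qed
    moreover have "ideal (J <+>\<^bsub>R\<^esub> PIdl y) R"
      by (intro add_ideals J(1) cgenideal_ideal R)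
    ultimately have "J <+>\<^bsub>R\<^esub> PIdl y = J"
      using J(4) y(2) add_cgenideal_supset(1)[OF J(1) R] by simp
    with add_cgenideal_supset(2)[OF J(1) R] show ?thesis by simp
  qed
  \<comment> \<open>From \<open>s \<otimes> y\<close> in \<open>J\<close>, hence in \<pp>, and
    \<open>s\<close> outside \<pp> it follows that \<open>y\<close> is in \<pp>, so
    \<open>absorb\<close> applies.\<close>
  have saturated: "y \<in> J" if "s \<in> carrier R - \<pp>" "y \<in> carrier R" "s \<otimes> y \<in> J" for s y
    using absorb[OF _ locally_acyclic_saturate[OF J(1,3) \<pp> that]] \<pp>.I_prime[of s y] J(2) that by blast
  have one: "\<one> \<notin> J" using \<pp>.notin_one J(2) by blast
  \<comment> \<open>A nonzerodivisor \<open>x\<close> modulo \<open>J\<close> could be adjoined and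
    would be absorbed, so it would lie in \<open>J\<close>; for \<open>x\<close> in \<open>J\<close>
    the witness is \<open>\<one>\<close>.\<close>
  have "\<exists>y\<in>carrier R - J. x \<otimes> y \<in> J" if x: "x \<in> \<pp>" for x
  proof (cases "x \<in> J")
    case True
    then show ?thesis
      using one \<pp>.Icarr[OF x] by (intro bexI[of _ \<one>]) auto
  next
    case False
    then show ?thesis
      using absorb[OF x] locally_acyclic_add_nonzerodivisor[OF J(1,3) \<pp> \<pp>.Icarr[OF x]] by blast
  qed
  then obtain y where y: "y \<in> carrier R" "y \<notin> J" "\<And>x. x \<in> \<pp> \<Longrightarrow> x \<otimes> y \<in> J"
    using ex_common_zero_divisor[OF J(1) \<pp>.is_ideal] by blast
  obtain f z where f: "f \<in> module_hom R (F 0) (regular_module R)"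
    "\<And>x. x \<in> carrier (F (Suc 0)) \<Longrightarrow> f (d 0 x) \<in> \<pp>" and z: "z \<in> carrier (F 0)" "f z \<notin> \<pp>"
    using ex_hom_to_residue_domain[OF assms(2,3)] by blast
  \<comment> \<open>A lift of the composite of M \<rightarrow> R / \<pp> with the map R / \<pp>
    \<rightarrow> R / J that sends 1 to \<open>y\<close>.\<close>
  let ?g = "\<lambda>x\<in>carrier (F 0). y \<otimes> f x \<ominus> \<zero> \<otimes> f x"
  have g: "?g x = f x \<otimes> y" if "x \<in> carrier (F 0)" for x
    using that y(1) regular_hom_closed[OF f(1) that] by (simp add: a_minus_def m_comm)
  have g_hom: "?g \<in> module_hom R (F 0) (regular_module R)"
    using y(1) f(1) by (intro regular_hom_combine) auto
  have "?g (d 0 x) \<in> J" if "x \<in> carrier (F (Suc 0))" for x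
    using y(3)[OF f(2)[OF that]] g[OF d_closed[OF that]] by simp
  from locally_acyclicD[OF J(3) g_hom this] obtain s c where s: "s \<in> carrier R - \<pp>"
    "c \<in> Hom_coboundaries R B d (regular_module R) 0"
    "\<And>x. x \<in> carrier (F 0) \<Longrightarrow> s \<otimes> ?g x \<ominus> c x \<in> J"
    by blast
  have fz: "f z \<in> carrier R" using regular_hom_closed[OF f(1) z(1)] .
  have "c z = \<zero>"
    using s(2) z(1) by (simp add: Hom_coboundaries_0)
  then have "s \<otimes> (f z \<otimes> y) \<in> J"
    using s(3)[OF z(1)] s(1) y(1) fz unfolding g[OF z(1)] by (simp add: a_minus_def)
  \<comment> \<open>The coboundary in degree 0 is zero, so only factors outside \<pp> remain:
    saturation cancels the denominator \<open>s\<close> and then \<open>f z\<close>.\<close>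
  then have "f z \<otimes> y \<in> J"
    using saturated[OF s(1)] fz y(1) by simp
  then have "y \<in> J"
    using saturated[of "f z" y] fz z(2) y(1) by simp
  with y(2) show False by simp
qed

end

section \<open>Comparison of the two supports\<close>

lemma module_dim_cong_Supp: "Supp R M = Supp R N \<Longrightarrow> module_dim R M = module_dim R N"
  by (simp add: module_dim_def)

text \<open>Infimum and supremum of \<open>Ext_degrees\<close> are both \<open>g\<close>, which
  squeezes every nonvanishing degree to \<open>g\<close>.\<close>

lemma quasi_perfect_Ext_zero:
  assumes "quasi_perfect R M" "grade R M = ereal (real g)" "i \<noteq> g"
  shows "\<not> nonzero_module (Ext R i M (regular_module R))"
proof
  assume "nonzero_module (Ext R i M (regular_module R))"
  then have i: "ereal (real i) \<in> Ext_degrees R M"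
    by (auto simp: Ext_degrees_def)
  have "ereal (real g) \<le> ereal (real i)" "ereal (real i) \<le> ereal (real g)"
    using Inf_lower[OF i] Sup_upper[OF i] assms(1,2) by (simp_all add: quasi_perfect_def grade_def)
  with assms(3) show False by simp
qed

theorem corollary2p8:
  fixes R :: "('r, 'e) ring_scheme" and M :: "('r, 'm) module" and g :: nat
  assumes "cring R" and "noetherian_ring R" and "local_ring R"
    and "module R M" and "finitely_generated_module R M"
    and "quasi_perfect R M" and "grade R M = ereal (real g)"
  shows "Supp R M = Supp R (Ext R g M (regular_module R)) \<and>
         module_dim R M = module_dim R (Ext R g M (regular_module R))"
proof -
  obtain B d \<epsilon> where res: "some_free_resolution R M = (B, d)" "free_resolution R M B d \<epsilon>"
    using some_free_resolution[OF assms(4)] by blast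
  interpret resolved_module R M B d \<epsilon>
    using assms(4) res(2) by (simp add: resolved_module_def resolved_module_axioms_def)
  have Ext: "Ext R i M (regular_module R) = Hom_cohomology R B d (regular_module R) i" for i
    by (simp add: Ext_def res(1))
  note N = regular_module_module
  have "\<pp> \<in> Supp R M \<longleftrightarrow> \<pp> \<in> Supp R (Ext R g M (regular_module R))" for \<pp>
  proof
    assume \<pp>: "\<pp> \<in> Supp R M"
    then have prime: "primeideal \<pp> R" by (simp add: Supp_def Spec_def)
    then interpret \<pp>: primeideal \<pp> R .
    show "\<pp> \<in> Supp R (Ext R g M (regular_module R))"
    proof (rule ccontr)
      assume not: "\<pp> \<notin> Supp R (Ext R g M (regular_module R))"
      \<comment> \<open>In degree \<open>g\<close> the denominator comes from \<pp> lying outside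
        the support of Ext; in the other degrees every cocycle is a coboundary and
        \<open>\<one>\<close> will do.\<close>
      have bdry: "\<exists>s\<in>carrier R - \<pp>. (\<lambda>x\<in>carrier (F i). s \<otimes>\<^bsub>R\<^esub> f x) \<in>
          Hom_coboundaries R B d (regular_module R) i"
        if f: "f \<in> Hom_cocycles R B d (regular_module R) i" for i f
      proof (cases "i = g")
        case True
        with not f prime show ?thesis
          unfolding Ext Supp_Hom_cohomology_iff[OF N] by auto
      next
        case False
        then have "Hom_cocycles R B d (regular_module R) i \<subseteq> Hom_coboundaries R B d (regular_module R) i"
          using quasi_perfect_Ext_zero[OF assms(6,7)] nonzero_Hom_cohomology_iff[OF N] unfolding Ext by blast
        with f coboundaries_smult[OF N one_closed, of f i] \<pp>.notin_one show ?thesis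
          by auto
      qed
      have "locally_acyclic \<pp> {\<zero>\<^bsub>R\<^esub>}"
        unfolding locally_acyclic_def
      proof (intro allI ballI impI)
        fix i f assume "f \<in> module_hom R (F i) (regular_module R)"
          "\<forall>x\<in>carrier (F (Suc i)). f (d i x) \<in> {\<zero>\<^bsub>R\<^esub>}"
        moreover from this have "f \<in> Hom_cocycles R B d (regular_module R) i"
          by (simp add: Hom_cocycles_iff)
        then obtain s where s: "s \<in> carrier R - \<pp>" "(\<lambda>x\<in>carrier (F i). s \<otimes>\<^bsub>R\<^esub> f x) \<in>
            Hom_coboundaries R B d (regular_module R) i"
          using bdry by blast
        \<comment> \<open>The coboundary is \<open>s f\<close> itself, so the difference is zero
          exactly, as membership in the zero ideal demands.\<close>
        ultimately show "\<exists>s\<in>carrier R - \<pp>. \<exists>c\<in>Hom_coboundaries R B d (regular_module R) i.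
            \<forall>x\<in>carrier (F i). s \<otimes>\<^bsub>R\<^esub> f x \<ominus>\<^bsub>R\<^esub> c x \<in> {\<zero>\<^bsub>R\<^esub>}"
          by (intro bexI[OF _ s(1)] bexI[OF _ s(2)])
            (auto simp: a_minus_def R.r_neg regular_hom_closed)
      qed
      with not_locally_acyclic[OF assms(2,5) \<pp>] show False by simp
    qed
  next
    assume \<pp>: "\<pp> \<in> Supp R (Ext R g M (regular_module R))"
    then have prime: "primeideal \<pp> R" by (simp add: Supp_def Spec_def)
    show "\<pp> \<in> Supp R M"
    proof (rule ccontr)
      assume "\<pp> \<notin> Supp R M"
      then obtain s where "s \<in> carrier R - \<pp>" "\<And>m. m \<in> carrier M \<Longrightarrow> s \<odot>\<^bsub>M\<^esub> m = \<zero>\<^bsub>M\<^esub>"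
        using ex_annihilator_if_notin_Supp[OF assms(4,5) prime] by blast
      with annihilator_cocycle_coboundary[OF _ _ N, of s _ g] \<pp> show False
        unfolding Ext Supp_Hom_cohomology_iff[OF N] by blast
    qed
  qed
  then have "Supp R M = Supp R (Ext R g M (regular_module R))" by blast
  then show ?thesis
    using module_dim_cong_Supp by blast
qed

end
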